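(* Let $x\in\mathbb{R}$ be fixed, let $f$ and $k$ be probability densities on $\mathbb{R}$ with characteristic functions $\phi_f$ and $\phi_k$, let $w$ be a kernel with Fourier transform $\phi_w$, and let $(h_n)$ and $(\sigma_n)$ be sequences of positive numbers. Assume that: (i) $\phi_f$ is integrable; (ii) $\phi_k(t)\ne 0$ for all $t\in\mathbb{R}$, and $\phi_k(t)t^{\beta}\to C$ and $\phi_k'(t)t^{\beta+1}\to-\beta C$ as $t\to\infty$, where $\beta\ge 0$ and $C\ne 0$ are some real constants; (iii) $\phi_w$ is symmetric and continuously differentiable; furthermore $\phi_w$ is supported on $[-1,1]$, $|\phi_w(t)|\le 1$ for all $t$, and $\phi_w(0)=1$; (iv) $h_n\to 0$ and $nh_n\to\infty$ as $n\to\infty$; (v) $\sigma_n\to 0$ and $\sigma_n/h_n\to\infty$ as $n\to\infty$. Let $f_{nh_n}(x)$ be the deconvolution kernel density estimator based on $X_1,\ldots,X_n$, where $X_j=Y_j+\sigma_nZ_j$, and put $\rho_n=h_n/\sigma_n$. Then $$\sqrt{nh_n\rho_n^{2\beta}}\,\bigl(f_{nh_n}(x)-\mathrm{E}[f_{nh_n}(x)]\bigr)\ \xrightarrow{\ \mathcal{D}\ }\ \mathcal{N}\left(0,\ \frac{f(x)}{2\pi C^2}\int_{-\infty}^{\infty}|t|^{2\beta}|\phi_w(t)|^2\,dt\right)$$ as $n\to\infty$.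
   Context: Model: for each $n$, one observes i.i.d. random variables $X_1,\ldots,X_n$ with $X_j=Y_j+\sigma_n Z_j$, where the $Y_j$ are i.i.d. with density $f$, the $Z_j$ are i.i.d. with known density $k$, and the $Y$'s and $Z$'s are independent. Here $\sigma_n$ depends on $n$. Conventions: $\phi_f(t)=\int e^{ity}f(y)\,dy$, $\phi_k(t)=\int e^{itz}k(z)\,dz$. The kernel $w$ is a real function on $\mathbb{R}$ (not necessarily nonnegative), with Fourier transform $\phi_w$, i.e. $w(x)=\frac{1}{2\pi}\int_{-\infty}^\infty e^{-itx}\phi_w(t)\,dt$. Since $\phi_f$ is integrable, $f$ is taken to be its continuous bounded version. The empirical characteristic function is $\phi_{emp}(t)=n^{-1}\sum_{j=1}^n e^{itX_j}$. The deconvolution kernel density estimator is $$f_{nh_n}(x)=\frac{1}{2\pi}\int_{-\infty}^{\infty}e^{-itx}\,\frac{\phi_w(h_nt)\,\phi_{emp}(t)}{\phi_k(\sigma_n t)}\,dt=\frac1n\sum_{j=1}^n\frac1{h_n}w_{\rho_n}\left(\frac{x-X_j}{h_n}\right),$$ where $w_{\rho_n}(u)=\frac{1}{2\pi}\int_{-\infty}^{\infty}e^{-itu}\frac{\phi_w(t)}{\phi_k(t/\rho_n)}\,dt$ and $\rho_n=h_n/\sigma_n$. $\xrightarrow{\mathcal D}$ denotes convergence in distribution; $\mathcal N(m,v)$ is the normal distribution with mean $m$ and variance $v$ (a point mass at $m$ if $v=0$). *)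

theory Defs
  imports "HOL-Probability.Probability"
begin

definition prob_density :: "(real \<Rightarrow> real) \<Rightarrow> bool" where
  "prob_density f \<longleftrightarrow>
     f \<in> borel_measurable borel \<and> (\<forall>y. 0 \<le> f y) \<and> (\<integral>\<^sup>+ y. ennreal (f y) \<partial>lborel) = 1"

definition char_density :: "(real \<Rightarrow> real) \<Rightarrow> real \<Rightarrow> complex" where
  "char_density f = char (density lborel (\<lambda>y. ennreal (f y)))"

lemma char_density_integral:
  assumes "prob_density f"
  shows "char_density f t = (CLBINT y. iexp (t * y) * complex_of_real (f y))"
proof -
  have "char_density f t = (CLBINT y. f y *\<^sub>R iexp (t * y))"
    unfolding char_density_def char_def
    using assms by (subst integral_density) (auto simp: prob_density_def)
  then show ?thesis
    by (simp add: scaleR_conv_of_real mult.commute)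
qed

definition emp_char :: "nat \<Rightarrow> (nat \<Rightarrow> real) \<Rightarrow> real \<Rightarrow> complex" where
  "emp_char n X t = (\<Sum>j=1..n. iexp (t * X j)) / of_nat n"

text \<open>Deconvolution kernel density estimator with bandwidth \<open>h\<close> and noise level \<open>\<sigma>\<close> at the
  point \<open>x\<close>, computed from the sample \<open>X 1, \<dots>, X n\<close>. When \<open>\<phi>w\<close> is the Fourier transform of a
  real kernel and \<open>\<phi>k\<close> that of a real density the inversion integral is real
  (\<open>deconv_kde_of_real\<close> below); \<open>Re\<close> only moves it from the type of complex numbers to that of
  reals.\<close>

definition deconv_kde ::
    "(real \<Rightarrow> complex) \<Rightarrow> (real \<Rightarrow> complex) \<Rightarrow> real \<Rightarrow> real \<Rightarrow> nat \<Rightarrow> (nat \<Rightarrow> real) \<Rightarrow> real \<Rightarrow> real" where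
  "deconv_kde \<phi>w \<phi>k h \<sigma> n X x =
     Re (1 / (2 * pi) *
         (CLBINT t. iexp (- (t * x)) * (\<phi>w (h * t) * emp_char n X t / \<phi>k (\<sigma> * t))))"

lemma emp_char_minus: "emp_char n X (- t) = cnj (emp_char n X t)"
  by (simp add: emp_char_def exp_cnj)

lemma deconv_kde_of_real:
  assumes w: "\<And>t. \<phi>w (- t) = cnj (\<phi>w t)" and k: "\<And>t. \<phi>k (- t) = cnj (\<phi>k t)"
  shows "complex_of_real (deconv_kde \<phi>w \<phi>k h \<sigma> n X x) =
     1 / (2 * pi) *
       (CLBINT t. iexp (- (t * x)) * (\<phi>w (h * t) * emp_char n X t / \<phi>k (\<sigma> * t)))"
proof -
  define g where "g t = iexp (- (t * x)) * (\<phi>w (h * t) * emp_char n X t / \<phi>k (\<sigma> * t))" for t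
  have g: "cnj (g t) = g (- t)" for t
    using w[of "h * t"] k[of "\<sigma> * t"] by (simp add: g_def emp_char_minus exp_cnj)
  have "cnj (CLBINT t. g t) = (CLBINT t. g (- t))"
    by (simp add: g flip: Bochner_Integration.integral_cnj)
  also have "\<dots> = (CLBINT t. g t)"
    using lborel_integral_real_affine[of "-1" g 0] by simp
  finally have "(CLBINT t. g t) \<in> \<real>"
    by (simp add: complex_is_Real_iff complex_eq_iff)
  then have "complex_of_real (1 / (2 * pi)) * (CLBINT t. g t) \<in> \<real>"
    by (intro Reals_mult) auto
  then show ?thesis
    unfolding deconv_kde_def g_def[symmetric] by (simp only: of_real_Re)
qed

text \<open>Normal distribution with mean \<open>m\<close> and variance \<open>v \<ge> 0\<close>. Note that \<open>normal_density\<close> takes the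
  standard deviation.\<close>

definition normal_measure :: "real \<Rightarrow> real \<Rightarrow> real measure" where
  "normal_measure m v =
     (if v = 0 then return borel m
      else density lborel (\<lambda>y. ennreal (normal_density m (sqrt v) y)))"

end

theory Submission
  imports Defs
begin

text \<open>
  With \<open>\<rho> = h / \<sigma>\<close> and \<open>a t = \<rho> powr \<beta> * \<phi>w t / \<phi>k (t / \<rho>)\<close>, the normalised centred estimator is
  \<open>\<Sum>j. (V j - E (V j)) / sqrt (n * h)\<close>, where \<open>2 * pi * V j\<close> is the Fourier transform of \<open>a\<close> at
  \<open>(X j - x) / h\<close>. The functions \<open>a\<close> are uniformly bounded and supported in \<open>[-1, 1]\<close>, so this is a sum
  of independent, uniformly small terms, and only its variance has to be found.

  Since the square of a Fourier transform is the transform of a convolution, Fubini's theorem expresses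
  \<open>4 * pi\<^sup>2 * E ((V j)\<^sup>2) / h\<close> as the integral over \<open>r\<close> of
  \<open>(a * a) (h r) e\<^sup>-\<^sup>i\<^sup>r\<^sup>x \<phi>f r \<phi>k (\<sigma> r)\<close>. As \<open>\<rho> \<rightarrow> 0\<close>, \<open>a t\<close> tends to
  \<open>A t = \<bar>t\<bar> powr \<beta> * \<phi>w t / C\<close> locally uniformly off \<open>0\<close>, and dominated convergence with the integrable
  majorant \<open>\<bar>\<phi>f\<bar>\<close> yields the limit \<open>(\<integral> A t * A (- t) dt) * (\<integral> e\<^sup>-\<^sup>i\<^sup>r\<^sup>x \<phi>f r dr)\<close>, whose second
  factor is \<open>2 * pi * f x\<close> by Fourier inversion. In the same way \<open>E (V j) = O(h)\<close>, which does not
  contribute. Inversion also shows that \<open>\<phi>w\<close> is real, because \<open>w\<close> is real and \<open>\<phi>w\<close> is even.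
\<close>

subsection \<open>Fourier transforms\<close>

definition fourier :: "(real \<Rightarrow> complex) \<Rightarrow> real \<Rightarrow> complex" where
  "fourier a y = (CLBINT t. iexp (t * y) * a t)"

lemma integrable_iexp_mult:
  assumes "integrable M a" "u \<in> borel_measurable M"
  shows "integrable M (\<lambda>t. iexp (u t) * a t)"
proof (rule Bochner_Integration.integrable_bound[OF assms(1)])
  show "(\<lambda>t. iexp (u t) * a t) \<in> borel_measurable M"
    using assms(2) borel_measurable_integrable[OF assms(1)] by measurable
qed (simp add: norm_mult)

lemma fourier_measurable [measurable]:
  assumes [measurable]: "a \<in> borel_measurable borel"
  shows "fourier a \<in> borel_measurable borel"
  unfolding fourier_def by measurable

lemma cmod_fourier_le: "cmod (fourier a y) \<le> (LBINT t. cmod (a t))"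
  unfolding fourier_def
  using integral_norm_bound[of lborel "\<lambda>t. iexp (t * y) * a t"] by (simp add: norm_mult)

lemma char_density_eq_fourier:
  assumes "prob_density f"
  shows "char_density f = fourier (\<lambda>y. complex_of_real (f y))"
  using char_density_integral[OF assms] by (simp add: fun_eq_iff fourier_def mult.commute)

text \<open>Fubini: the exponential has modulus one, \<open>a\<close> is integrable and
  \<open>\<mu>\<close> is finite. This multiplication formula trades an expectation for an integral
  against a characteristic function; it serves both the moments of the estimator and the Gaussian
  smoothing in the inversion theorem.\<close>

lemma integral_fourier:
  assumes \<mu>: "real_distribution \<mu>" and a: "integrable lborel a"
  shows "(CLINT y|\<mu>. fourier a y) = (CLBINT t. a t * char \<mu> t)"
proof -
  interpret \<mu>: real_distribution \<mu> by fact
  interpret P: pair_sigma_finite lborel \<mu> ..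
  have [measurable]: "a \<in> borel_measurable borel"
    using borel_measurable_integrable[OF a] by simp
  have int: "integrable (lborel \<Otimes>\<^sub>M \<mu>) (\<lambda>(t, y). iexp (t * y) * a t)"
  proof (rule P.Fubini_integrable)
    show "(\<lambda>(t, y). iexp (t * y) * a t) \<in> borel_measurable (lborel \<Otimes>\<^sub>M \<mu>)"
      by measurable
    show "integrable lborel (\<lambda>t. LINT y|\<mu>. cmod (case (t, y) of (t, y) \<Rightarrow> iexp (t * y) * a t))"
      using \<mu>.prob_space a by (simp add: norm_mult)
    show "AE t in lborel. integrable \<mu> (\<lambda>y. case (t, y) of (t, y) \<Rightarrow> iexp (t * y) * a t)"
      by (auto intro!: integrable_mult_left \<mu>.integrable_iexp)
  qed
  have "(CLINT y|\<mu>. fourier a y) = (CLBINT t. (CLINT y|\<mu>. iexp (t * y) * a t))"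
    unfolding fourier_def by (rule P.Fubini_integral[OF int])
  also have "\<dots> = (CLBINT t. a t * char \<mu> t)"
    by (simp add: char_def mult.commute)
  finally show ?thesis .
qed

definition conv :: "(real \<Rightarrow> complex) \<Rightarrow> (real \<Rightarrow> complex) \<Rightarrow> real \<Rightarrow> complex" where
  "conv a b r = (CLBINT t. a t * b (r - t))"

lemma integrable_shift:
  fixes b :: "real \<Rightarrow> complex"
  assumes "integrable lborel b"
  shows "integrable lborel (\<lambda>r. b (r - t))" "(LBINT r. cmod (b (r - t))) = (LBINT r. cmod (b r))"
  using lborel_integrable_real_affine[OF assms, of 1 "- t"]
    lborel_integral_real_affine[of 1 "\<lambda>r. cmod (b r)" "- t"] by simp_all

text \<open>Fubini for \<open>a t * b (r - t)\<close>, whose absolute integral is the product of the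
  two L1 norms; shifting \<open>r\<close> by \<open>t\<close> splits the exponential. With
  \<open>a = b\<close> the square of a transform becomes a single transform, to which
  \<open>integral_fourier\<close> applies.\<close>

lemma
  assumes a: "integrable lborel a" and b: "integrable lborel b"
  shows integrable_conv: "integrable lborel (conv a b)"
    and fourier_conv: "fourier (conv a b) y = fourier a y * fourier b y"
proof -
    have [measurable]: "a \<in> borel_measurable borel" "b \<in> borel_measurable borel"
    using borel_measurable_integrable a b by auto
  have int: "integrable (lborel \<Otimes>\<^sub>M lborel) (\<lambda>(t, r). a t * b (r - t))"
  proof (rule lborel_pair.Fubini_integrable)
    show "integrable lborel (\<lambda>t. LBINT r. cmod (case (t, r) of (t, r) \<Rightarrow> a t * b (r - t)))"
      using a by (simp add: norm_mult integrable_shift(2)[OF b])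
    show "AE t in lborel. integrable lborel (\<lambda>r. case (t, r) of (t, r) \<Rightarrow> a t * b (r - t))"
      using integrable_shift(1)[OF b] by simp
  qed measurable
  show "integrable lborel (conv a b)"
    using lborel_pair.integrable_snd[OF int] by (simp add: conv_def[abs_def])
  have int2: "integrable (lborel \<Otimes>\<^sub>M lborel) (\<lambda>(t, r). iexp (r * y) * (a t * b (r - t)))"
    using integrable_iexp_mult[OF int, of "\<lambda>p. snd p * y"] by (simp add: split_beta')
  have "fourier (conv a b) y = (CLBINT r. CLBINT t. iexp (r * y) * (a t * b (r - t)))"
    by (simp add: fourier_def conv_def)
  also have "\<dots> = (CLBINT t. CLBINT r. iexp (r * y) * (a t * b (r - t)))"
    by (rule lborel_pair.Fubini_integral[OF int2])
  also have "\<dots> = (CLBINT t. iexp (t * y) * a t * fourier b y)"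
  proof (rule Bochner_Integration.integral_cong[OF refl])
    fix t
    have "(CLBINT r. iexp (r * y) * (a t * b (r - t)))
        = (CLBINT r. iexp ((t + r) * y) * (a t * b r))"
      using lborel_integral_real_affine[of 1 "\<lambda>r. iexp (r * y) * (a t * b (r - t))" t] by simp
    also have "\<dots> = (CLBINT r. (iexp (t * y) * a t) * (iexp (r * y) * b r))"
      by (simp add: exp_add[symmetric] distrib_left distrib_right mult_ac add_ac)
    finally show "(CLBINT r. iexp (r * y) * (a t * b (r - t))) = iexp (t * y) * a t * fourier b y"
      by (simp add: fourier_def)
  qed
  also have "\<dots> = fourier a y * fourier b y"
    by (simp add: fourier_def)
  finally show "fourier (conv a b) y = fourier a y * fourier b y" .
qed

lemma fourier_affine:
  assumes "c > 0"
  shows "fourier (\<lambda>y. g (x + c * y)) z = iexp (- (z / c * x)) * fourier g (z / c) / c"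
proof -
  have "fourier g (z / c) = of_real c * (CLBINT y. iexp ((x + c * y) * (z / c)) * g (x + c * y))"
    unfolding fourier_def
    using lborel_integral_real_affine[of c "\<lambda>y. iexp (y * (z / c)) * g y" x] assms
    by (simp add: scaleR_conv_of_real)
  also have "(\<lambda>y. iexp ((x + c * y) * (z / c)) * g (x + c * y))
      = (\<lambda>y. iexp (z / c * x) * (iexp (y * z) * g (x + c * y)))"
  proof
    fix y
    have "(x + c * y) * (z / c) = z / c * x + y * z"
      using assms by (simp add: field_simps)
    then show "iexp ((x + c * y) * (z / c)) * g (x + c * y) = iexp (z / c * x) * (iexp (y * z) * g (x + c * y))"
      by (simp only: of_real_add distrib_left exp_add mult.assoc)
  qed
  finally have "fourier g (z / c) = c * iexp (z / c * x) * fourier (\<lambda>y. g (x + c * y)) z"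
    by (simp add: fourier_def)
  then show ?thesis
    using assms by (simp add: exp_minus)
qed

text \<open>A Gaussian weight of scale \<epsilon> reduces inversion to the multiplication formula.
  As \<epsilon> tends to 0 both sides converge by dominated convergence: integrability of
  \<open>fourier g\<close> controls the frequency side, boundedness and continuity of
  \<open>g\<close> the other one.\<close>

lemma fourier_inversion:
  fixes g :: "real \<Rightarrow> complex"
  assumes g: "integrable lborel g" and cont: "continuous_on UNIV g" and bdd: "bounded (range g)"
    and fg: "integrable lborel (fourier g)"
  shows "(CLBINT t. iexp (- (t * x)) * fourier g t) = 2 * pi * g x"
proof -
  obtain B where B: "cmod (g y) \<le> B" for y
    using bdd by (auto simp: bounded_iff)
  have [measurable]: "g \<in> borel_measurable borel" "fourier g \<in> borel_measurable borel"
    using borel_measurable_integrable g fg by auto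
  define \<epsilon> where "\<epsilon> n = 1 / real (Suc n)" for n
  have \<epsilon>: "\<epsilon> n > 0" for n by (simp add: \<epsilon>_def)
  have \<epsilon>_lim: "\<epsilon> \<longlonglongrightarrow> 0"
    unfolding \<epsilon>_def using LIMSEQ_inverse_real_of_nat by (simp add: inverse_eq_divide)
  have \<phi>: "integrable lborel (\<lambda>y::real. exp (- (y\<^sup>2) / 2))" "(LBINT y. exp (- (y\<^sup>2) / 2)) = sqrt (2 * pi)"
  proof -
    have eq: "exp (- (y\<^sup>2) / 2) = sqrt (2 * pi) * std_normal_density y" for y :: real
      by (simp add: normal_density_def)
    show "integrable lborel (\<lambda>y::real. exp (- (y\<^sup>2) / 2))" 
      unfolding eq by simp
    show "(LBINT y. exp (- (y\<^sup>2) / 2)) = sqrt (2 * pi)"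
      unfolding eq by simp
  qed
  \<comment> \<open>Gaussian smoothing: apply \<open>integral_fourier\<close> to \<open>y \<mapsto> g (x + \<epsilon> y)\<close> and the standard normal law\<close>
  have smooth: "(CLBINT t. std_normal_density (\<epsilon> n * t) *\<^sub>R (iexp (- (t * x)) * fourier g t))
      = (CLBINT y. g (x + \<epsilon> n * y) * of_real (exp (- (y\<^sup>2) / 2)))" for n
  proof -
    have "(CLBINT y. g (x + \<epsilon> n * y) * of_real (exp (- (y\<^sup>2) / 2)))
        = (CLINT z|std_normal_distribution. fourier (\<lambda>y. g (x + \<epsilon> n * y)) z)"
      using integral_fourier[OF real_dist_normal_dist, of "\<lambda>y. g (x + \<epsilon> n * y)"] \<epsilon>[of n] g
      by (simp add: char_std_normal_distribution lborel_integrable_real_affine)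
    also have "\<dots> = (CLBINT z. std_normal_density z *\<^sub>R
        (iexp (- (z / \<epsilon> n * x)) * fourier g (z / \<epsilon> n) / \<epsilon> n))"
      by (subst integral_density) (auto simp: fourier_affine[OF \<epsilon>] normal_density_nonneg)
    also have "\<dots> = (CLBINT t. std_normal_density (\<epsilon> n * t) *\<^sub>R (iexp (- (t * x)) * fourier g t))"
      using \<epsilon>[of n]
      by (subst lborel_integral_real_affine[where c = "\<epsilon> n" and t = 0])
         (simp_all add: scaleR_conv_of_real)
    finally show ?thesis by simp
  qed
  \<comment> \<open>The limit is the integrand at \<epsilon> = 0, kept in the form
    \<open>0 * t\<close>; the weight there is the constant \<open>1 / sqrt (2 * pi)\<close>.\<close>
  have lim1: "(\<lambda>n. CLBINT t. std_normal_density (\<epsilon> n * t) *\<^sub>R (iexp (- (t * x)) * fourier g t))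
      \<longlonglongrightarrow> (CLBINT t. std_normal_density (0 * t) *\<^sub>R (iexp (- (t * x)) * fourier g t))"
  proof (rule integral_dominated_convergence[where w = "\<lambda>t. cmod (fourier g t)"])
    show "AE t in lborel. (\<lambda>n. std_normal_density (\<epsilon> n * t) *\<^sub>R (iexp (- (t * x)) * fourier g t))
        \<longlonglongrightarrow> std_normal_density (0 * t) *\<^sub>R (iexp (- (t * x)) * fourier g t)"
      unfolding normal_density_def by (intro AE_I2 tendsto_intros \<epsilon>_lim) auto
    have "std_normal_density s \<le> 1" for s
    proof -
      have "exp (- s\<^sup>2 / 2) \<le> sqrt (2 * pi)"
        by (rule order_trans[of _ 1]) (use pi_gt3 in auto)
      then show ?thesis by (simp add: normal_density_def divide_le_eq)
    qed
    then show "AE t in lborel. cmod (std_normal_density (\<epsilon> n * t) *\<^sub>R (iexp (- (t * x)) * fourier g t))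
        \<le> cmod (fourier g t)" for n
      by (simp add: norm_mult mult_left_le_one_le normal_density_nonneg)
  qed (use fg in auto)
  have lim2: "(\<lambda>n. CLBINT y. g (x + \<epsilon> n * y) * of_real (exp (- (y\<^sup>2) / 2)))
      \<longlonglongrightarrow> (CLBINT y. g x * of_real (exp (- (y\<^sup>2) / 2)))"
  proof (rule integral_dominated_convergence[where w = "\<lambda>y. B * exp (- (y\<^sup>2) / 2)"])
    show "AE y in lborel. (\<lambda>n. g (x + \<epsilon> n * y) * of_real (exp (- (y\<^sup>2) / 2)))
        \<longlonglongrightarrow> g x * of_real (exp (- (y\<^sup>2) / 2))"
    proof (intro AE_I2 tendsto_intros)
      fix y
      have "isCont g x" using cont by (simp add: continuous_on_eq_continuous_at)
      moreover have "(\<lambda>n. x + \<epsilon> n * y) \<longlonglongrightarrow> x"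
        using tendsto_add[OF tendsto_const tendsto_mult[OF \<epsilon>_lim tendsto_const], of x y] by simp
      ultimately show "(\<lambda>n. g (x + \<epsilon> n * y)) \<longlonglongrightarrow> g x"
        by (rule isCont_tendsto_compose)
    qed
  qed (use \<phi> B in \<open>auto simp: norm_mult intro!: mult_right_mono\<close>)
  have "(CLBINT t. std_normal_density (0 * t) *\<^sub>R (iexp (- (t * x)) * fourier g t))
      = (CLBINT y. g x * of_real (exp (- (y\<^sup>2) / 2)))"
    by (rule LIMSEQ_unique[OF lim1[unfolded smooth] lim2])
  also have "(CLBINT y. g x * of_real (exp (- (y\<^sup>2) / 2))) = g x * of_real (sqrt (2 * pi))"
    using \<phi> by (simp flip: of_real_exp of_real_power add: integral_complex_of_real)
  finally have *: "of_real (1 / sqrt (2 * pi)) * (CLBINT t. iexp (- (t * x)) * fourier g t)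
      = g x * of_real (sqrt (2 * pi))"
    by (simp add: normal_density_def scaleR_conv_of_real flip: integral_mult_right_zero)
  \<comment> \<open>One factor \<open>sqrt (2 * pi)\<close> undoes the normalising constant of the
    density, the other is the Gaussian integral.\<close>
  have "(CLBINT t. iexp (- (t * x)) * fourier g t)
      = of_real (sqrt (2 * pi)) * (of_real (1 / sqrt (2 * pi)) * (CLBINT t. iexp (- (t * x)) * fourier g t))"
    by simp
  also have "\<dots> = of_real (sqrt (2 * pi) * sqrt (2 * pi)) * g x"
    unfolding * of_real_mult by (simp only: mult_ac)
  also have "sqrt (2 * pi) * sqrt (2 * pi) = 2 * pi" by simp
  finally show ?thesis by simp
qed

subsection \<open>A central limit theorem for bounded triangular arrays\<close>

lemma real_distribution_normal_measure:
  assumes "0 \<le> v"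
  shows "real_distribution (normal_measure m v)"
proof (cases "v = 0")
  case True
  then show ?thesis
    using prob_space_return[of m borel]
    by (simp add: normal_measure_def real_distribution_def real_distribution_axioms_def)
next
  case False
  then show ?thesis
    using assms prob_space_normal_density[of "sqrt v" m]
    by (simp add: normal_measure_def real_distribution_def real_distribution_axioms_def)
qed

lemma char_normal_measure:
  assumes "0 \<le> v"
  shows "char (normal_measure 0 v) t = of_real (exp (- (t\<^sup>2 * v / 2)))"
proof (cases "v = 0")
  case True
  then show ?thesis
    by (simp add: normal_measure_def char_def integral_return)
next
  case False
  define s where "s = sqrt v"
  have s: "s > 0" "s\<^sup>2 = v" using False assms by (auto simp: s_def)
  have "char (normal_measure 0 v) t = (CLBINT x. normal_density 0 s x *\<^sub>R iexp (t * x))"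
    using False unfolding normal_measure_def char_def s_def[symmetric]
    by (simp add: integral_density normal_density_nonneg)
  also have "\<dots> = (CLBINT z. std_normal_density z *\<^sub>R iexp ((t * s) * z))"
    using s(1)
    by (subst lborel_integral_real_affine[where c = s and t = 0])
       (simp_all add: normal_density_def real_sqrt_mult power_mult_distrib scaleR_conv_of_real mult_ac)
  also have "\<dots> = char std_normal_distribution (t * s)"
    unfolding char_def by (simp add: integral_density normal_density_nonneg)
  finally show ?thesis
    unfolding s(2)[symmetric] by (simp add: char_std_normal_distribution power_mult_distrib flip: exp_of_real)
qed

text \<open>One side is \<open>1 - a \<le> exp (- a)\<close>. For the other,
  \<open>exp (- a) \<le> 1 / (1 + a) \<le> 1 - a + a^2\<close>, because
  \<open>(1 - a + a^2) * (1 + a) = 1 + a^3\<close>.\<close>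

lemma abs_exp_minus_approx:
  fixes a :: real
  assumes "0 \<le> a"
  shows "\<bar>exp (- a) - (1 - a)\<bar> \<le> a\<^sup>2"
proof -
  have "exp (- a) \<le> 1 / (1 + a)"
    using assms exp_ge_add_one_self[of a] by (simp add: exp_minus inverse_eq_divide frac_le)
  also have "1 \<le> (1 - a + a\<^sup>2) * (1 + a)"
    using assms by (simp add: algebra_simps power2_eq_square)
  then have "1 / (1 + a) \<le> 1 - a + a\<^sup>2"
    using assms by (simp add: divide_le_eq)
  finally show ?thesis
    using exp_ge_add_one_self[of "- a"] by simp
qed

text \<open>Both functions are compared with \<open>1 - t^2 * s / 2\<close>. Boundedness replaces
  the third absolute moment by \<open>c * s\<close>, and \<open>s \<le> c^2\<close> replaces
  \<open>s^2\<close> by \<open>c^2 * s\<close>. The error is thus proportional to \<open>s\<close>,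
  so that errors summed over a row are controlled by the row variance.\<close>

lemma (in prob_space) char_bounded_approx:
  assumes [measurable]: "random_variable borel X"
    and bound: "\<And>\<omega>. \<omega> \<in> space M \<Longrightarrow> \<bar>X \<omega>\<bar> \<le> c"
    and mean: "expectation X = 0"
  defines "s \<equiv> expectation (\<lambda>\<omega>. (X \<omega>)\<^sup>2)"
  shows "cmod (char (distr M borel X) t - of_real (exp (- (t\<^sup>2 * s / 2))))
    \<le> (\<bar>t\<bar> ^ 3 * c + t ^ 4 * c\<^sup>2) * s"
proof -
  have c0: "0 \<le> c"
    using bound not_empty by (meson abs_ge_zero ex_in_conv order_trans)
  have int: "integrable M X" and int2: "integrable M (\<lambda>\<omega>. (X \<omega>)\<^sup>2)"
  proof -
    show "integrable M X" by (rule integrable_const_bound[where B = c]) (use bound in auto)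
    show "integrable M (\<lambda>\<omega>. (X \<omega>)\<^sup>2)"
      by (rule integrable_const_bound[where B = "c\<^sup>2"]) (use bound c0 in \<open>auto simp: abs_le_square_iff[symmetric]\<close>)
  qed
  have s0: "0 \<le> s" unfolding s_def by simp
  have sc: "s \<le> c\<^sup>2"
    unfolding s_def
    by (rule integral_le_const[OF int2]) (use bound c0 in \<open>auto simp: abs_le_square_iff[symmetric]\<close>)
  have "cmod (char (distr M borel X) t - (1 - t\<^sup>2 * s / 2))
      \<le> t\<^sup>2 / 6 * expectation (\<lambda>\<omega>. min (6 * (X \<omega>)\<^sup>2) (\<bar>t\<bar> * \<bar>X \<omega>\<bar> ^ 3))"
    using char_approx3'[OF assms(1) int int2 mean _ refl, of s t] mean
    by (simp add: s_def)
  also have "\<dots> \<le> t\<^sup>2 / 6 * (\<bar>t\<bar> * c * s)"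
  proof (rule mult_left_mono)
    \<comment> \<open>Only the cubic branch of the minimum is kept, with one factor
      \<open>\<bar>X \<omega>\<bar>\<close> bounded by \<open>c\<close>.\<close>
    have "expectation (\<lambda>\<omega>. min (6 * (X \<omega>)\<^sup>2) (\<bar>t\<bar> * \<bar>X \<omega>\<bar> ^ 3)) \<le> expectation (\<lambda>\<omega>. \<bar>t\<bar> * c * (X \<omega>)\<^sup>2)"
    proof (rule integral_mono)
      show "integrable M (\<lambda>\<omega>. \<bar>t\<bar> * c * (X \<omega>)\<^sup>2)" using int2 by simp
      show "integrable M (\<lambda>\<omega>. min (6 * (X \<omega>)\<^sup>2) (\<bar>t\<bar> * \<bar>X \<omega>\<bar> ^ 3))"
        by (rule Bochner_Integration.integrable_bound[OF integrable_mult_right[OF int2, of 6]]) auto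
      fix \<omega> assume "\<omega> \<in> space M"
      then have "\<bar>t\<bar> * (\<bar>X \<omega>\<bar> * \<bar>X \<omega>\<bar>\<^sup>2) \<le> \<bar>t\<bar> * (c * \<bar>X \<omega>\<bar>\<^sup>2)"
        using bound by (intro mult_left_mono mult_right_mono) auto
      then show "min (6 * (X \<omega>)\<^sup>2) (\<bar>t\<bar> * \<bar>X \<omega>\<bar> ^ 3) \<le> \<bar>t\<bar> * c * (X \<omega>)\<^sup>2"
        by (simp add: power3_eq_cube power2_eq_square mult_ac min.coboundedI2)
    qed
    then show "expectation (\<lambda>\<omega>. min (6 * (X \<omega>)\<^sup>2) (\<bar>t\<bar> * \<bar>X \<omega>\<bar> ^ 3)) \<le> \<bar>t\<bar> * c * s"
      by (simp add: s_def)
  qed simp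
  also have "\<dots> = (\<bar>t\<bar> ^ 3 * c * s) / 6"
    by (simp add: power3_eq_cube power2_eq_square)
  also have "\<dots> \<le> \<bar>t\<bar> ^ 3 * c * s"
    using c0 s0 by simp
  finally have 1: "cmod (char (distr M borel X) t - (1 - t\<^sup>2 * s / 2)) \<le> \<bar>t\<bar> ^ 3 * c * s" .
  have "cmod ((1 - t\<^sup>2 * s / 2) - of_real (exp (- (t\<^sup>2 * s / 2)))) = \<bar>exp (- (t\<^sup>2 * s / 2)) - (1 - t\<^sup>2 * s / 2)\<bar>"
  proof -
    have "(1 - t\<^sup>2 * s / 2) - of_real (exp (- (t\<^sup>2 * s / 2))) = complex_of_real ((1 - t\<^sup>2 * s / 2) - exp (- (t\<^sup>2 * s / 2)))"
      by simp
    then show ?thesis by (simp only: norm_of_real abs_minus_commute)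
  qed
  also have "\<dots> \<le> (t\<^sup>2 * s / 2)\<^sup>2"
    using s0 by (intro abs_exp_minus_approx) auto
  also have "\<dots> = (t ^ 4 * s * s) / 4"
    by (simp add: power2_eq_square eval_nat_numeral)
  also have "\<dots> \<le> t ^ 4 * s * s"
    using s0 by simp
  also have "\<dots> \<le> t ^ 4 * c\<^sup>2 * s"
    using s0 sc by (intro mult_right_mono mult_left_mono) auto
  finally have 2: "cmod ((1 - t\<^sup>2 * s / 2) - of_real (exp (- (t\<^sup>2 * s / 2)))) \<le> t ^ 4 * c\<^sup>2 * s" .
  show ?thesis
    using norm_triangle_ineq[of "char (distr M borel X) t - (1 - t\<^sup>2 * s / 2)"
        "(1 - t\<^sup>2 * s / 2) - of_real (exp (- (t\<^sup>2 * s / 2)))"] 1 2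
    by (simp add: distrib_right)
qed

text \<open>By independence the characteristic function of a row sum is a product. Replacing its
  factors by Gaussian ones costs at most the sum of the individual errors, since all factors have
  modulus at most one. The bounds \<open>c n\<close> tending to 0 do the work of Lindeberg's
  condition, and Levy's continuity theorem concludes.\<close>

lemma triangular_array_clt:
  fixes M :: "nat \<Rightarrow> 'a measure" and \<xi> :: "nat \<Rightarrow> 'i \<Rightarrow> 'a \<Rightarrow> real"
  assumes M: "\<And>n. prob_space (M n)"
    and fin: "\<And>n. finite (I n)"
    and indep: "\<And>n. prob_space.indep_vars (M n) (\<lambda>_. borel) (\<xi> n) (I n)"
    and bound: "\<forall>\<^sub>F n in sequentially. \<forall>i\<in>I n. \<forall>\<omega>\<in>space (M n). \<bar>\<xi> n i \<omega>\<bar> \<le> c n"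
    and c: "c \<longlonglongrightarrow> 0"
    and mean: "\<And>n i. i \<in> I n \<Longrightarrow> integral\<^sup>L (M n) (\<xi> n i) = 0"
    and var: "(\<lambda>n. \<Sum>i\<in>I n. LINT \<omega>|M n. (\<xi> n i \<omega>)\<^sup>2) \<longlonglongrightarrow> v"
  shows "weak_conv_m (\<lambda>n. distr (M n) borel (\<lambda>\<omega>. \<Sum>i\<in>I n. \<xi> n i \<omega>)) (normal_measure 0 v)"
proof (rule levy_continuity)
  have rv: "\<xi> n i \<in> borel_measurable (M n)" if "i \<in> I n" for n i
    using that by (rule prob_space.indep_vars_def2[OF M, THEN iffD1, OF indep, THEN conjunct1, rule_format])
  define s where "s n i = (LINT \<omega>|M n. (\<xi> n i \<omega>)\<^sup>2)" for n i
  have s0: "0 \<le> s n i" for n i by (simp add: s_def)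
  have v0: "0 \<le> v"
    by (rule tendsto_lowerbound[OF var]) (auto intro!: always_eventually sum_nonneg)
  show "real_distribution (distr (M n) borel (\<lambda>\<omega>. \<Sum>i\<in>I n. \<xi> n i \<omega>))" for n
    by (rule prob_space.real_distribution_distr[OF M]) (use rv in auto)
  show "real_distribution (normal_measure 0 v)"
    using v0 by (rule real_distribution_normal_measure)
  fix t
  have diff: "(\<lambda>n. char (distr (M n) borel (\<lambda>\<omega>. \<Sum>i\<in>I n. \<xi> n i \<omega>)) t
      - of_real (exp (- (t\<^sup>2 * (\<Sum>i\<in>I n. s n i) / 2)))) \<longlonglongrightarrow> 0"
  proof (rule Lim_null_comparison)
    show "(\<lambda>n. (\<bar>t\<bar> ^ 3 * c n + t ^ 4 * (c n)\<^sup>2) * (\<Sum>i\<in>I n. s n i)) \<longlonglongrightarrow> 0"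
    proof -
      have "(\<lambda>n. (\<bar>t\<bar> ^ 3 * c n + t ^ 4 * (c n)\<^sup>2) * (\<Sum>i\<in>I n. s n i))
          \<longlonglongrightarrow> (\<bar>t\<bar> ^ 3 * 0 + t ^ 4 * 0\<^sup>2) * v"
        unfolding s_def by (intro tendsto_mult tendsto_add tendsto_power tendsto_const c var)
      then show ?thesis by simp
    qed
    show "\<forall>\<^sub>F n in sequentially. cmod (char (distr (M n) borel (\<lambda>\<omega>. \<Sum>i\<in>I n. \<xi> n i \<omega>)) t
      - of_real (exp (- (t\<^sup>2 * (\<Sum>i\<in>I n. s n i) / 2)))) \<le> (\<bar>t\<bar> ^ 3 * c n + t ^ 4 * (c n)\<^sup>2) * (\<Sum>i\<in>I n. s n i)"
      using bound
    proof eventually_elim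
      case (elim n)
      interpret prob_space "M n" by (rule M)
      \<comment> \<open>The Gaussian factor of the whole row splits into one factor per summand,
        which allows a comparison of two products.\<close>
      have "exp (- (t\<^sup>2 * (\<Sum>i\<in>I n. s n i) / 2)) = (\<Prod>i\<in>I n. exp (- (t\<^sup>2 * s n i / 2)))"
        by (simp add: exp_sum[OF fin, symmetric] sum_negf sum_distrib_left sum_divide_distrib)
      then have "cmod (char (distr (M n) borel (\<lambda>\<omega>. \<Sum>i\<in>I n. \<xi> n i \<omega>)) t
          - of_real (exp (- (t\<^sup>2 * (\<Sum>i\<in>I n. s n i) / 2))))
        = cmod ((\<Prod>i\<in>I n. char (distr (M n) borel (\<xi> n i)) t) - (\<Prod>i\<in>I n. of_real (exp (- (t\<^sup>2 * s n i / 2)))))"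
        by (simp only: char_distr_sum[OF indep] of_real_prod)
      also have "\<dots> \<le> (\<Sum>i\<in>I n. cmod (char (distr (M n) borel (\<xi> n i)) t - of_real (exp (- (t\<^sup>2 * s n i / 2)))))"
      proof (rule norm_prod_diff)
        show "cmod (char (distr (M n) borel (\<xi> n i)) t) \<le> 1" if "i \<in> I n" for i
          by (rule real_distribution.cmod_char_le_1[OF real_distribution_distr[OF rv[OF that]]])
      qed (use s0 in \<open>simp del: of_real_exp\<close>)
      also have "\<dots> \<le> (\<Sum>i\<in>I n. (\<bar>t\<bar> ^ 3 * c n + t ^ 4 * (c n)\<^sup>2) * s n i)"
        unfolding s_def using elim by (intro sum_mono char_bounded_approx rv mean) auto
      finally show ?case by (simp only: sum_distrib_left)
    qed
  qed
  have "(\<lambda>n. complex_of_real (exp (- (t\<^sup>2 * (\<Sum>i\<in>I n. s n i) / 2)))) \<longlonglongrightarrow> char (normal_measure 0 v) t"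
    unfolding char_normal_measure[OF v0] s_def by (intro tendsto_intros var) auto
  then show "(\<lambda>n. char (distr (M n) borel (\<lambda>\<omega>. \<Sum>i\<in>I n. \<xi> n i \<omega>)) t) \<longlonglongrightarrow> char (normal_measure 0 v) t"
    by (rule Lim_transform[OF _ diff])
qed

subsection \<open>Real-valuedness, convolutions and moments\<close>

lemma cnj_fourier: "cnj (fourier a y) = fourier (\<lambda>t. cnj (a (- t))) y"
proof -
  have "cnj (fourier a y) = (CLBINT t. cnj (iexp (t * y) * a t))"
    unfolding fourier_def by (rule Bochner_Integration.integral_cnj[symmetric])
  also have "\<dots> = (CLBINT t. iexp (t * y) * cnj (a (- t)))"
    by (subst lborel_integral_real_affine[where c = "-1" and t = 0]) (simp_all add: exp_cnj)
  finally show ?thesis by (simp add: fourier_def)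
qed

lemma fourier_real:
  assumes "\<And>t. a (- t) = cnj (a t)"
  shows "of_real (Re (fourier a y)) = fourier a y"
  using cnj_fourier[of a y] assms by (simp add: complex_eq_iff)

text \<open>For even \<open>g\<close>, conjugating \<open>g\<close> conjugates its transform; if the
  transform is real, \<open>g\<close> and its conjugate share it. This passes from a real kernel to
  a real \<open>\<phi>w\<close>.\<close>

lemma real_of_real_fourier:
  assumes g: "integrable lborel g" "continuous_on UNIV g" "bounded (range g)"
    and sym: "\<And>t. g (- t) = g t" and real: "\<And>u. fourier g u \<in> \<real>"
  shows "cnj (g t) = g t"
proof -
  \<comment> \<open>the Fourier transform of \<open>d\<close> vanishes, hence is integrable, and inversion gives \<open>d = 0\<close>\<close>
  define d where "d t = g t - cnj (g t)" for t
  have gc: "integrable lborel (\<lambda>t. cnj (g t))"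
    using g(1) by simp
  have "fourier d u = fourier g u - fourier (\<lambda>t. cnj (g t)) u" for u
    unfolding fourier_def d_def
    using integrable_iexp_mult[OF g(1), of "\<lambda>t. t * u"] integrable_iexp_mult[OF gc, of "\<lambda>t. t * u"]
    by (simp add: right_diff_distrib)
  moreover have "fourier (\<lambda>t. cnj (g t)) u = fourier g u" for u
    using cnj_fourier[of g u] real[of u] by (simp add: sym Reals_cnj_iff)
  ultimately have fd: "fourier d = (\<lambda>_. 0)"
    by auto
  obtain B where B: "\<And>y. cmod (g y) \<le> B"
    using g(3) by (auto simp: bounded_iff)
  have "cmod (d y) \<le> B + B" for y
    unfolding d_def using B[of y] norm_triangle_ineq4[of "g y" "cnj (g y)"] by simp
  then have "bounded (range d)"
    by (auto simp: bounded_iff)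
  moreover have "continuous_on UNIV d"
    unfolding d_def by (intro continuous_intros g(2))
  moreover have "integrable lborel d"
    unfolding d_def using g(1) gc by simp
  ultimately have "2 * pi * d t = 0"
    using fourier_inversion[of d t] by (simp add: fd)
  then show ?thesis by (simp add: d_def)
qed

lemma (in prob_space) char_affine:
  assumes [measurable]: "random_variable borel X"
  shows "char (distr M borel (\<lambda>\<omega>. (X \<omega> - x) / h)) t
    = iexp (- (t / h * x)) * char (distr M borel X) (t / h)"
proof -
  have "iexp (t * ((y - x) / h)) = iexp (- (t / h * x)) * iexp (t / h * y)" for y
  proof -
    have "t * ((y - x) / h) = - (t / h * x) + t / h * y"
      by (simp add: diff_divide_distrib right_diff_distrib)
    then show ?thesis by (simp only: of_real_add distrib_left exp_add)
  qed
  then show ?thesis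
    unfolding char_def by (simp add: integral_distr del: of_real_mult of_real_divide of_real_minus of_real_diff)
qed

text \<open>The multiplication formula for the law of \<open>(X - x) / h\<close>, followed by the
  substitution \<open>t = h * r\<close>. The factor \<open>h\<close> this brings out is the order of
  magnitude of the moments computed later.\<close>

lemma (in prob_space) expectation_fourier_affine:
  assumes [measurable]: "random_variable borel X" and a: "integrable lborel a" and h: "0 < h"
  shows "(CLINT \<omega>|M. fourier a ((X \<omega> - x) / h))
    = h * (CLBINT r. a (h * r) * (iexp (- (r * x)) * char (distr M borel X) r))"
proof -
  have [measurable]: "a \<in> borel_measurable borel"
    using borel_measurable_integrable[OF a] by simp
  have "(CLINT \<omega>|M. fourier a ((X \<omega> - x) / h))
      = (CLINT y|distr M borel (\<lambda>\<omega>. (X \<omega> - x) / h). fourier a y)"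
    by (simp add: integral_distr)
  also have "\<dots> = (CLBINT t. a t * (iexp (- (t / h * x)) * char (distr M borel X) (t / h)))"
    by (subst integral_fourier[OF real_distribution_distr a]) (simp_all add: char_affine)
  also have "\<dots> = h * (CLBINT r. a (h * r) * (iexp (- (r * x)) * char (distr M borel X) r))"
    using h by (subst lborel_integral_real_affine[where c = h and t = 0]) (simp_all add: scaleR_conv_of_real)
  finally show ?thesis .
qed

lemma integrable_bounded_support:
  fixes a :: "real \<Rightarrow> complex"
  assumes "a \<in> borel_measurable borel" "\<And>t. t \<notin> {-1..1} \<Longrightarrow> a t = 0" "\<And>t. cmod (a t) \<le> K"
  shows "integrable lborel a"
proof (rule Bochner_Integration.integrable_bound[where f = "\<lambda>t. K * indicator {-1..1::real} t"])
  show "AE t in lborel. cmod (a t) \<le> norm (K * indicator {- 1..1} t :: real)"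
    using assms(2,3) by (auto simp: indicator_def intro!: AE_I2 order_trans[OF assms(3)])
qed (use assms(1) in auto)

lemma integral_cmod_bounded_support:
  fixes a :: "real \<Rightarrow> complex"
  assumes "a \<in> borel_measurable borel" "\<And>t. t \<notin> {-1..1} \<Longrightarrow> a t = 0" "\<And>t. cmod (a t) \<le> K"
  shows "(LBINT t. cmod (a t)) \<le> 2 * K"
proof -
  have "(LBINT t. cmod (a t)) \<le> (LBINT t. K * indicator {-1..1::real} t)"
  proof (rule Bochner_Integration.integral_mono)
    show "integrable lborel (\<lambda>t. cmod (a t))"
      using integrable_bounded_support[OF assms] by simp
    show "cmod (a t) \<le> K * indicator {-1..1} t" for t
      using assms(2)[of t] assms(3)[of t] by (simp add: indicator_def)
  qed simp
  then show ?thesis by simp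
qed

lemma cmod_conv_le:
  assumes "a \<in> borel_measurable borel" "\<And>t. t \<notin> {-1..1} \<Longrightarrow> a t = 0" "\<And>t. cmod (a t) \<le> K"
  shows "cmod (conv a a r) \<le> 2 * K\<^sup>2"
proof -
  note [measurable] = assms(1)
  have K: "0 \<le> K" using assms(3)[of 0] norm_ge_zero order_trans by blast
  have "(LBINT t. cmod (a t * a (r - t))) \<le> 2 * K\<^sup>2"
  proof (rule integral_cmod_bounded_support)
    show "cmod (a t * a (r - t)) \<le> K\<^sup>2" for t
      using assms(3)[of t] assms(3)[of "r - t"] K
      by (auto simp: norm_mult power2_eq_square intro!: mult_mono)
  qed (use assms(2) in auto)
  then show ?thesis
    unfolding conv_def by (rule order_trans[OF integral_norm_bound])
qed

text \<open>Convergence along moving arguments \<open>s n\<close> is assumed because the second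
  factor is evaluated at \<open>u n - t\<close>, which varies with \<open>n\<close>. The excluded
  point 0 is a null set, and the common support and bound give the majorant.\<close>

lemma conv_tendsto:
  assumes a: "\<And>n. a n \<in> borel_measurable borel" and A: "A \<in> borel_measurable borel"
    and supp: "\<And>n t. t \<notin> {-1..1} \<Longrightarrow> a n t = 0" and K: "\<And>n t. cmod (a n t) \<le> K"
    and lim: "\<And>t s. t \<noteq> 0 \<Longrightarrow> s \<longlonglongrightarrow> t \<Longrightarrow> (\<lambda>n. a n (s n)) \<longlonglongrightarrow> A t"
    and u: "u \<longlonglongrightarrow> (0::real)"
  shows "(\<lambda>n. conv (a n) (a n) (u n)) \<longlonglongrightarrow> (CLBINT t. A t * A (- t))"
  unfolding conv_def
proof (rule integral_dominated_convergence[where w = "\<lambda>t. K\<^sup>2 * indicator {-1..1::real} t"])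
  note [measurable] = a A
  have K0: "0 \<le> K" using K[of 0 0] norm_ge_zero order_trans by blast
  show "AE t in lborel. cmod (a n t * a n (u n - t)) \<le> K\<^sup>2 * indicator {-1..1} t" for n
    using supp[of _ n] K[of n] K0
    by (auto simp: norm_mult power2_eq_square indicator_def intro!: mult_mono)
  show "AE t in lborel. (\<lambda>n. a n t * a n (u n - t)) \<longlonglongrightarrow> A t * A (- t)"
    using AE_lborel_singleton[of 0]
  proof eventually_elim
    case (elim t)
    show ?case
      using tendsto_diff[OF u tendsto_const, of t] elim
      by (intro tendsto_mult lim) auto
  qed
  show "(\<lambda>t. A t * A (- t)) \<in> borel_measurable lborel" by measurable
  show "(\<lambda>t. a n t * a n (u n - t)) \<in> borel_measurable lborel" for n by measurable
qed auto

text \<open>For fixed \<open>r\<close> the convolution is evaluated near 0 and tends to a constant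
  independent of \<open>r\<close>, while \<open>char \<kappa> (\<sigma> n * r)\<close> tends to 1;
  hence the limit factorises. The majorant is \<open>2 * K^2 * cmod (F r)\<close>, the interval of
  integration having length 2.\<close>

lemma conv_integral_tendsto:
  assumes a: "\<And>n. a n \<in> borel_measurable borel" and A: "A \<in> borel_measurable borel"
    and supp: "\<And>n t. t \<notin> {-1..1} \<Longrightarrow> a n t = 0" and K: "\<And>n t. cmod (a n t) \<le> K"
    and lim: "\<And>t s. t \<noteq> 0 \<Longrightarrow> s \<longlonglongrightarrow> t \<Longrightarrow> (\<lambda>n. a n (s n)) \<longlonglongrightarrow> A t"
    and h: "h \<longlonglongrightarrow> (0::real)" and \<sigma>: "\<sigma> \<longlonglongrightarrow> (0::real)"
    and F: "integrable lborel F"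
    and \<kappa>: "real_distribution \<kappa>"
  shows "(\<lambda>n. CLBINT r. conv (a n) (a n) (h n * r) * (iexp (- (r * x)) * (F r * char \<kappa> (\<sigma> n * r))))
    \<longlonglongrightarrow> (CLBINT t. A t * A (- t)) * (CLBINT r. iexp (- (r * x)) * F r)"
proof -
  interpret \<kappa>: real_distribution \<kappa> by fact
  have [measurable]: "F \<in> borel_measurable borel"
    using borel_measurable_integrable[OF F] by simp
  note [measurable] = a
  have [measurable]: "conv (a n) (a n) \<in> borel_measurable borel" for n
    unfolding conv_def[abs_def] by measurable
  have K0: "0 \<le> K" using K[of 0 0] norm_ge_zero order_trans by blast
  have "(\<lambda>n. CLBINT r. conv (a n) (a n) (h n * r) * (iexp (- (r * x)) * (F r * char \<kappa> (\<sigma> n * r))))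
    \<longlonglongrightarrow> (CLBINT r. (CLBINT t. A t * A (- t)) * (iexp (- (r * x)) * (F r * char \<kappa> 0)))"
  proof (rule integral_dominated_convergence[where w = "\<lambda>r. 2 * K\<^sup>2 * cmod (F r)"])
    show "AE r in lborel. cmod (conv (a n) (a n) (h n * r) * (iexp (- (r * x)) * (F r * char \<kappa> (\<sigma> n * r))))
        \<le> 2 * K\<^sup>2 * cmod (F r)" for n
    proof (rule AE_I2)
      fix r
      have "cmod (iexp (- (r * x)) * (F r * char \<kappa> (\<sigma> n * r))) \<le> cmod (F r)"
        using \<kappa>.cmod_char_le_1[of "\<sigma> n * r"] by (simp add: norm_mult mult_left_le)
      then show "cmod (conv (a n) (a n) (h n * r) * (iexp (- (r * x)) * (F r * char \<kappa> (\<sigma> n * r))))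
        \<le> 2 * K\<^sup>2 * cmod (F r)"
        unfolding norm_mult[of "conv _ _ _"] using cmod_conv_le[OF a supp K]
        by (intro mult_mono) auto
    qed
    show "AE r in lborel. (\<lambda>n. conv (a n) (a n) (h n * r) * (iexp (- (r * x)) * (F r * char \<kappa> (\<sigma> n * r))))
        \<longlonglongrightarrow> (CLBINT t. A t * A (- t)) * (iexp (- (r * x)) * (F r * char \<kappa> 0))"
    proof (intro AE_I2 tendsto_mult tendsto_const)
      fix r
      have "(\<lambda>n. h n * r) \<longlonglongrightarrow> 0" using tendsto_mult_right[OF h, of r] by simp
      then show "(\<lambda>n. conv (a n) (a n) (h n * r)) \<longlonglongrightarrow> (CLBINT t. A t * A (- t))"
        by (intro conv_tendsto[OF a A supp K lim]) auto
      have "(\<lambda>n. \<sigma> n * r) \<longlonglongrightarrow> 0" using tendsto_mult_right[OF \<sigma>, of r] by simp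
      then show "(\<lambda>n. char \<kappa> (\<sigma> n * r)) \<longlonglongrightarrow> char \<kappa> 0"
        by (rule isCont_tendsto_compose[OF \<kappa>.isCont_char])
    qed
  qed (use F in auto)
  then show ?thesis
    by (simp add: \<kappa>.char_zero)
qed

lemma cmod_integral_bounded_mult:
  fixes g :: "real \<Rightarrow> complex"
  assumes "integrable lborel F" "\<And>r. cmod (g r) \<le> K * cmod (F r)"
  shows "cmod (CLBINT r. g r) \<le> K * (LBINT r. cmod (F r))"
proof (cases "integrable lborel g")
  case True
  then have "(LBINT r. cmod (g r)) \<le> (LBINT r. K * cmod (F r))"
    using assms by (intro Bochner_Integration.integral_mono) auto
  then show ?thesis
    using order_trans[OF integral_norm_bound] by simp
next
  case False
  \<comment> \<open>The integral of a non-integrable function is 0 by convention, so here the bound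
    only has to be non-negative.\<close>
  have "0 \<le> (LBINT r. K * cmod (F r))"
    using assms(2) by (intro Bochner_Integration.integral_nonneg) (meson norm_ge_zero order_trans)
  with False show ?thesis
    by (simp add: not_integrable_integral_eq)
qed

subsection \<open>Tail behaviour of the noise characteristic function\<close>

lemma char_minus: "char M (- t) = cnj (char M t)"
proof -
  have "char M (- t) = (CLINT x|M. cnj (iexp (t * x)))"
    by (simp add: char_def exp_cnj)
  then show ?thesis by (simp add: char_def flip: Bochner_Integration.integral_cnj)
qed

lemma cmod_char_abs: "cmod (char M \<bar>t\<bar>) = cmod (char M t)"
  by (cases "0 \<le> t") (simp_all add: char_minus)

text \<open>Two regimes of \<open>u = \<bar>t\<bar> / \<rho>\<close>. For large \<open>u\<close> the
  tail bounds \<open>cmod (char \<kappa> u) * u powr \<beta>\<close> below by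
  \<open>\<bar>C\<bar> / 2\<close>, and \<open>\<rho> powr \<beta> * u powr \<beta> \<le> 1\<close>.
  On the remaining compact interval the modulus has a positive minimum, and \<rho> is at most
  \<open>R\<close>.\<close>

lemma powr_over_char_bounded:
  assumes \<kappa>: "real_distribution \<kappa>" and nz: "\<And>t. char \<kappa> t \<noteq> 0"
    and tail: "((\<lambda>t. char \<kappa> t * complex_of_real (t powr \<beta>)) \<longlongrightarrow> complex_of_real C) at_top"
    and C: "C \<noteq> 0" and \<beta>: "0 \<le> \<beta>"
  obtains K where "\<And>\<rho> t. 0 < \<rho> \<Longrightarrow> \<rho> \<le> R \<Longrightarrow> \<bar>t\<bar> \<le> 1 \<Longrightarrow> cmod (of_real (\<rho> powr \<beta>) / char \<kappa> (t / \<rho>)) \<le> K"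
proof -
  interpret \<kappa>: real_distribution \<kappa> by fact
  have "((\<lambda>t. cmod (char \<kappa> t) * t powr \<beta>) \<longlongrightarrow> \<bar>C\<bar>) at_top"
    using tendsto_norm[OF tail] by (simp add: norm_mult)
  then have "\<forall>\<^sub>F t in at_top. \<bar>C\<bar> / 2 < cmod (char \<kappa> t) * t powr \<beta>"
    using C by (intro order_tendstoD(1)) auto
  then obtain S0 where S0: "\<And>t. t \<ge> S0 \<Longrightarrow> \<bar>C\<bar> / 2 < cmod (char \<kappa> t) * t powr \<beta>"
    by (auto simp: eventually_at_top_linorder)
  \<comment> \<open>The maximum with 1 makes \<open>{0..S}\<close> nonempty and forces
    \<open>u > 0\<close> in the tail regime.\<close>
  define S where "S = max S0 1"
  have cont: "continuous_on {0..S} (\<lambda>t. cmod (char \<kappa> t))"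
    by (intro continuous_on_norm continuous_at_imp_continuous_on ballI \<kappa>.isCont_char)
  have "{0..S} \<noteq> {}" by (simp add: S_def)
  then obtain s where s: "\<And>t. t \<in> {0..S} \<Longrightarrow> cmod (char \<kappa> s) \<le> cmod (char \<kappa> t)"
    using continuous_attains_inf[OF compact_Icc _ cont] by blast
  define m where "m = cmod (char \<kappa> s)"
  have m: "m > 0" using nz by (simp add: m_def)
  have "cmod (of_real (\<rho> powr \<beta>) / char \<kappa> (t / \<rho>)) \<le> 2 / \<bar>C\<bar> + R powr \<beta> / m"
    if \<rho>: "0 < \<rho>" "\<rho> \<le> R" and t: "\<bar>t\<bar> \<le> 1" for \<rho> t
  proof -
    define u where "u = \<bar>t\<bar> / \<rho>"
    have u0: "0 \<le> u" using \<rho> by (simp add: u_def)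
    have eq: "cmod (of_real (\<rho> powr \<beta>) / char \<kappa> (t / \<rho>)) = \<rho> powr \<beta> / cmod (char \<kappa> u)"
      using cmod_char_abs[of \<kappa> "t / \<rho>"] \<rho> by (simp add: norm_divide u_def)
    show ?thesis
    proof (cases "u \<ge> S")
      case True
      then have u: "u > 0" and C2: "\<bar>C\<bar> / 2 < cmod (char \<kappa> u) * u powr \<beta>"
        using S0[of u] by (auto simp: S_def)
      have "\<rho> powr \<beta> * u powr \<beta> = \<bar>t\<bar> powr \<beta>"
        using \<rho> by (simp add: u_def flip: powr_mult)
      also have "\<dots> \<le> 1" using t \<beta> by (intro powr_le1) auto
      finally have "\<rho> powr \<beta> \<le> 1 / u powr \<beta>"
        using u by (simp add: field_simps)
      then have "\<rho> powr \<beta> / cmod (char \<kappa> u) \<le> 1 / u powr \<beta> / cmod (char \<kappa> u)"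
        by (intro divide_right_mono) auto
      also have "\<dots> = 1 / (cmod (char \<kappa> u) * u powr \<beta>)"
        by simp
      also have "\<dots> \<le> 1 / (\<bar>C\<bar> / 2)"
        using C C2 by (intro divide_left_mono mult_pos_pos) auto
      finally show ?thesis
        unfolding eq using m by (intro add_increasing2) simp_all
    next
      case False
      then have "m \<le> cmod (char \<kappa> u)" using s[of u] u0 by (simp add: m_def)
      then have "\<rho> powr \<beta> / cmod (char \<kappa> u) \<le> R powr \<beta> / m"
        using m \<rho> \<beta> by (intro frac_le powr_mono2) auto
      then show ?thesis
        unfolding eq by (intro add_increasing) simp_all
    qed
  qed
  then show thesis by (rule that)
qed

text \<open>With \<open>u n = \<bar>s n\<bar> / \<rho> n\<close>, which tends to infinity, the
  quotient is \<open>\<bar>s n\<bar> powr \<beta>\<close> divided by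
  \<open>char \<kappa> (s n / \<rho> n) * u n powr \<beta>\<close>, and this denominator tends to
  \<open>C\<close>. For negative \<open>t\<close> the tail limit is conjugated, which leaves the
  real \<open>C\<close> unchanged.\<close>

lemma powr_over_char_tendsto:
  assumes nz: "\<And>t. char \<kappa> t \<noteq> 0"
    and tail: "((\<lambda>t. char \<kappa> t * complex_of_real (t powr \<beta>)) \<longlongrightarrow> complex_of_real C) at_top"
    and C: "C \<noteq> 0"
    and \<rho>: "\<rho> \<longlonglongrightarrow> 0" "\<And>n. 0 < \<rho> n" and t: "t \<noteq> 0" and s: "s \<longlonglongrightarrow> t"
  shows "(\<lambda>n. of_real (\<rho> n powr \<beta>) / char \<kappa> (s n / \<rho> n)) \<longlonglongrightarrow> of_real (\<bar>t\<bar> powr \<beta> / C)"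
proof -
  define u where "u n = \<bar>s n\<bar> / \<rho> n" for n
  have "filterlim u at_top sequentially"
    unfolding u_def using \<rho> t
    by (intro LIM_at_top_divide[of _ "\<bar>t\<bar>"]) (auto intro!: tendsto_rabs s)
  then have lim: "(\<lambda>n. char \<kappa> (u n) * of_real (u n powr \<beta>)) \<longlonglongrightarrow> of_real C"
    by (rule filterlim_compose[OF tail])
  have sn: "\<forall>\<^sub>F n in sequentially. s n \<noteq> 0"
    using tendsto_imp_eventually_ne[OF s t] .
  have lim': "(\<lambda>n. char \<kappa> (s n / \<rho> n) * of_real (u n powr \<beta>)) \<longlonglongrightarrow> of_real C"
  proof (cases "t > 0")
    case True
    have "\<forall>\<^sub>F n in sequentially. s n > 0" using order_tendstoD(1)[OF s True] .
    then have "\<forall>\<^sub>F n in sequentially. char \<kappa> (u n) * of_real (u n powr \<beta>) = char \<kappa> (s n / \<rho> n) * of_real (u n powr \<beta>)"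
      by eventually_elim (simp add: u_def)
    then show ?thesis by (rule Lim_transform_eventually[OF lim])
  next
    case False
    then have "\<forall>\<^sub>F n in sequentially. s n < 0" using order_tendstoD(2)[OF s, of 0] t by simp
    then have "\<forall>\<^sub>F n in sequentially. cnj (char \<kappa> (u n) * of_real (u n powr \<beta>)) = char \<kappa> (s n / \<rho> n) * of_real (u n powr \<beta>)"
      by eventually_elim (simp add: u_def char_minus)
    moreover have "(\<lambda>n. cnj (char \<kappa> (u n) * of_real (u n powr \<beta>))) \<longlonglongrightarrow> of_real C"
      using tendsto_cnj[OF lim] by simp
    ultimately show ?thesis by (rule Lim_transform_eventually[rotated])
  qed
  have "(\<lambda>n. of_real (\<bar>s n\<bar> powr \<beta>) / (char \<kappa> (s n / \<rho> n) * of_real (u n powr \<beta>))) \<longlonglongrightarrow> of_real (\<bar>t\<bar> powr \<beta>) / complex_of_real C"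
    using t C by (intro tendsto_divide lim' tendsto_of_real tendsto_powr tendsto_rabs s tendsto_const) auto
  moreover have "\<forall>\<^sub>F n in sequentially. of_real (\<bar>s n\<bar> powr \<beta>) / (char \<kappa> (s n / \<rho> n) * of_real (u n powr \<beta>))
      = of_real (\<rho> n powr \<beta>) / char \<kappa> (s n / \<rho> n)"
    using sn
  proof eventually_elim
    case (elim n)
    then have "u n > 0" using \<rho>(2)[of n] by (simp add: u_def)
    moreover have "\<bar>s n\<bar> powr \<beta> = \<rho> n powr \<beta> * u n powr \<beta>"
      using \<rho>(2)[of n] by (simp add: u_def flip: powr_mult)
    ultimately show ?case by simp
  qed
  ultimately show ?thesis
    using Lim_transform_eventually by simp
qed

subsection \<open>The deconvolution estimator\<close>

text \<open>Joint independence is used blockwise: the disjoint blocks \<open>{Inl j, Inr j}\<close>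
  give independent observations, and the singletons inside one block give independence of signal and
  noise, hence the product of characteristic functions.\<close>

lemma (in prob_space)
  fixes Y Z :: "'i \<Rightarrow> 'a \<Rightarrow> real"
  assumes ind: "indep_vars (\<lambda>_. borel) (case_sum Y Z) (I <+> I)"
  shows indep_vars_add_noise: "indep_vars (\<lambda>_. borel) (\<lambda>j \<omega>. Y j \<omega> + s * Z j \<omega>) I"
    and char_add_noise: "j \<in> I \<Longrightarrow> char (distr M borel (\<lambda>\<omega>. Y j \<omega> + s * Z j \<omega>)) t
      = char (distr M borel (Y j)) t * char (distr M borel (Z j)) (s * t)"
proof -
  have "indep_vars (\<lambda>j. PiM {Inl j, Inr j} (\<lambda>_. borel)) (\<lambda>j \<omega>. restrict (\<lambda>i. case_sum Y Z i \<omega>) {Inl j, Inr j}) I"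
    by (rule indep_vars_restrict[OF ind]) (auto simp: disjoint_family_on_def)
  then have "indep_vars (\<lambda>_. borel) (\<lambda>j \<omega>. (\<lambda>f. f (Inl j) + s * f (Inr j)) (restrict (\<lambda>i. case_sum Y Z i \<omega>) {Inl j, Inr j})) I"
    by (rule indep_vars_compose2) measurable
  then show "indep_vars (\<lambda>_. borel) (\<lambda>j \<omega>. Y j \<omega> + s * Z j \<omega>) I"
    by simp
  assume j: "j \<in> I"
  have "indep_var (PiM {Inl j} (\<lambda>_. borel)) (\<lambda>\<omega>. restrict (\<lambda>i. case_sum Y Z i \<omega>) {Inl j})
      (PiM {Inr j} (\<lambda>_. borel)) (\<lambda>\<omega>. restrict (\<lambda>i. case_sum Y Z i \<omega>) {Inr j})"
    using j by (intro indep_var_restrict[OF ind]) auto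
  then have "indep_var borel ((\<lambda>f. f (Inl j)) \<circ> (\<lambda>\<omega>. restrict (\<lambda>i. case_sum Y Z i \<omega>) {Inl j}))
      borel ((\<lambda>f. s * f (Inr j)) \<circ> (\<lambda>\<omega>. restrict (\<lambda>i. case_sum Y Z i \<omega>) {Inr j}))"
    by (rule indep_var_compose) measurable
  then have YZ: "indep_var borel (Y j) borel (\<lambda>\<omega>. s * Z j \<omega>)"
    by (simp add: comp_def)
  have [measurable]: "random_variable borel (Z j)"
    using ind j by (auto simp: indep_vars_def2 dest: bspec[of _ _ "Inr j"])
  have "char (distr M borel (\<lambda>\<omega>. s * Z j \<omega>)) t = char (distr M borel (Z j)) (s * t)"
    by (simp add: char_def integral_distr mult_ac)
  then show "char (distr M borel (\<lambda>\<omega>. Y j \<omega> + s * Z j \<omega>)) t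
      = char (distr M borel (Y j)) t * char (distr M borel (Z j)) (s * t)"
    by (simp add: char_distr_add[OF YZ])
qed

lemma real_distribution_density:
  assumes "prob_density k"
  shows "real_distribution (density lborel (\<lambda>y. ennreal (k y)))"
proof -
  have "prob_space (density lborel (\<lambda>y. ennreal (k y)))"
    using assms by (intro prob_spaceI) (simp add: prob_density_def emeasure_density)
  then show ?thesis
    by (simp add: real_distribution_def real_distribution_axioms_def)
qed

lemma char_distributed:
  assumes "distributed M lborel Y (\<lambda>y. ennreal (f y))"
  shows "char (distr M borel Y) = char_density f"
proof -
  have "distr M borel Y = distr M lborel Y" by (rule distr_cong) auto
  then show ?thesis
    using distributed_distr_eq_density[OF assms] by (simp add: char_density_def)
qed

text \<open>Sum and integral are exchanged and \<open>t\<close> is rescaled by \<open>h\<close>,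
  using \<open>h * t / \<rho> = \<sigma> * t\<close>. The factor \<open>\<rho> powr \<beta>\<close>
  put into \<open>a\<close>, which later keeps it bounded as \<rho> tends to 0, is divided out
  again.\<close>

lemma deconv_kde_eq_sum:
  fixes \<phi>w \<phi>k :: "real \<Rightarrow> complex" and h \<sigma> \<beta> :: real
  assumes h: "0 < h" and \<sigma>: "0 < \<sigma>"
  defines "\<rho> \<equiv> h / \<sigma>"
  defines "a \<equiv> (\<lambda>t. of_real (\<rho> powr \<beta>) * \<phi>w t / \<phi>k (t / \<rho>))"
  assumes a: "integrable lborel a"
  shows "deconv_kde \<phi>w \<phi>k h \<sigma> n X x
    = (\<Sum>j=1..n. Re (fourier a ((X j - x) / h)) / (2 * pi)) / (n * h * \<rho> powr \<beta>)"
proof -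
  have \<rho>: "\<rho> > 0" using h \<sigma> by (simp add: \<rho>_def)
  have ht: "h * t / \<rho> = \<sigma> * t" for t using h \<sigma> by (simp add: \<rho>_def)
  have scale: "(CLBINT t. iexp (t * (y - x)) * a (h * t)) = fourier a ((y - x) / h) / h" for y
    unfolding fourier_def using h
    by (subst (2) lborel_integral_real_affine[where c = h and t = 0]) (simp_all add: scaleR_conv_of_real mult_ac)
  have int: "integrable lborel (\<lambda>t. iexp (t * (y - x)) * a (h * t))" for y
    using lborel_integrable_real_affine[OF a, of h 0] h by (intro integrable_iexp_mult) auto
  have "iexp (- (t * x)) * (\<phi>w (h * t) * emp_char n X t / \<phi>k (\<sigma> * t))
      = (\<Sum>j=1..n. iexp (t * (X j - x)) * a (h * t)) / (of_nat n * of_real (\<rho> powr \<beta>))" for t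
  proof -
    have "a (h * t) = of_real (\<rho> powr \<beta>) * (\<phi>w (h * t) / \<phi>k (\<sigma> * t))"
      by (simp add: a_def ht)
    moreover have "iexp (t * (X j - x)) = iexp (- (t * x)) * iexp (t * X j)" for j
    proof -
      have "t * (X j - x) = - (t * x) + t * X j" by (simp add: right_diff_distrib)
      then show ?thesis by (simp only: of_real_add distrib_left exp_add)
    qed
    ultimately have "(\<Sum>j=1..n. iexp (t * (X j - x)) * a (h * t))
        = of_real (\<rho> powr \<beta>) * (iexp (- (t * x)) * (\<phi>w (h * t) / \<phi>k (\<sigma> * t)) * (\<Sum>j=1..n. iexp (t * X j)))"
      by (simp only: sum_distrib_left sum_distrib_right mult_ac)
    then show ?thesis
      using \<rho> by (simp add: emp_char_def)
  qed
  then have "(CLBINT t. iexp (- (t * x)) * (\<phi>w (h * t) * emp_char n X t / \<phi>k (\<sigma> * t)))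
      = (\<Sum>j=1..n. fourier a ((X j - x) / h) / h) / (of_nat n * of_real (\<rho> powr \<beta>))"
    by (simp only: integral_divide_zero Bochner_Integration.integral_sum[OF int] scale)
  also have "\<dots> = (\<Sum>j=1..n. fourier a ((X j - x) / h)) / of_real (n * h * \<rho> powr \<beta>)"
    by (simp add: mult_ac flip: sum_divide_distrib)
  finally have "deconv_kde \<phi>w \<phi>k h \<sigma> n X x
      = Re ((\<Sum>j=1..n. fourier a ((X j - x) / h)) / of_real (2 * pi * (n * h * \<rho> powr \<beta>)))"
    by (simp add: deconv_kde_def)
  then show ?thesis
    by (simp only: Re_divide_of_real Re_sum) (simp flip: sum_divide_distrib)
qed

theorem theorem3:
  fixes x :: real
    and f k w :: "real \<Rightarrow> real"
    and \<phi>w :: "real \<Rightarrow> complex"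
    and h \<sigma> :: "nat \<Rightarrow> real"
    and \<beta> C :: real
    and M :: "nat \<Rightarrow> 'a measure"
    and Y Z X :: "nat \<Rightarrow> nat \<Rightarrow> 'a \<Rightarrow> real"
    and est :: "nat \<Rightarrow> 'a \<Rightarrow> real"
  assumes f_density: "prob_density f"
    and k_density: "prob_density k"
    and h_pos: "\<And>n. 0 < h n"
    and \<sigma>_pos: "\<And>n. 0 < \<sigma> n"
    \<comment> \<open>(i), with \<open>f\<close> being the continuous bounded version of the density\<close>
    and \<phi>f_integrable: "integrable lborel (char_density f)"
    and f_continuous: "continuous_on UNIV f"
    and f_bounded: "bounded (range f)"
    \<comment> \<open>(ii)\<close>
    and \<phi>k_nonzero: "\<And>t. char_density k t \<noteq> 0"
    and \<beta>_nonneg: "0 \<le> \<beta>"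
    and C_nonzero: "C \<noteq> 0"
    and \<phi>k_tail: "((\<lambda>t. char_density k t * complex_of_real (t powr \<beta>))
                    \<longlongrightarrow> complex_of_real C) at_top"
    and \<phi>k_differentiable: "\<forall>\<^sub>F t in at_top. char_density k differentiable at t"
    and \<phi>k_deriv_tail: "((\<lambda>t. vector_derivative (char_density k) (at t)
                              * complex_of_real (t powr (\<beta> + 1)))
                    \<longlongrightarrow> complex_of_real (- \<beta> * C)) at_top"
    \<comment> \<open>(iii), with \<open>\<phi>w\<close> being the Fourier transform of the real kernel \<open>w\<close>\<close>
    and w_fourier: "\<And>u. complex_of_real (w u) = 1 / (2 * pi) * (CLBINT t. iexp (- (t * u)) * \<phi>w t)"
    and \<phi>w_symmetric: "\<And>t. \<phi>w (- t) = \<phi>w t"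
    and \<phi>w_C1: "\<phi>w C1_differentiable_on UNIV"
    and \<phi>w_support: "\<And>t. t \<notin> {-1..1} \<Longrightarrow> \<phi>w t = 0"
    and \<phi>w_le_1: "\<And>t. cmod (\<phi>w t) \<le> 1"
    and \<phi>w_0: "\<phi>w 0 = 1"
    \<comment> \<open>(iv)\<close>
    and h_tendsto: "h \<longlonglongrightarrow> 0"
    and nh_tendsto: "filterlim (\<lambda>n. real n * h n) at_top sequentially"
    \<comment> \<open>(v)\<close>
    and \<sigma>_tendsto: "\<sigma> \<longlonglongrightarrow> 0"
    and \<sigma>_h_tendsto: "filterlim (\<lambda>n. \<sigma> n / h n) at_top sequentially"
    \<comment> \<open>the model: for each \<open>n\<close>, a sample of size \<open>n\<close> on a probability space \<open>M n\<close>\<close>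
    and M_prob: "\<And>n. prob_space (M n)"
    and Y_distr: "\<And>n j. j \<in> {1..n} \<Longrightarrow> distributed (M n) lborel (Y n j) (\<lambda>y. ennreal (f y))"
    and Z_distr: "\<And>n j. j \<in> {1..n} \<Longrightarrow> distributed (M n) lborel (Z n j) (\<lambda>z. ennreal (k z))"
    \<comment> \<open>\<open>Y n 1, \<dots>, Y n n, Z n 1, \<dots>, Z n n\<close> are jointly independent\<close>
    and YZ_indep: "\<And>n. prob_space.indep_vars (M n) (\<lambda>_. borel)
                       (case_sum (Y n) (Z n)) ({1..n} <+> {1..n})"
    and X_def: "\<And>n j \<omega>. X n j \<omega> = Y n j \<omega> + \<sigma> n * Z n j \<omega>"
    and est_def: "\<And>n \<omega>. est n \<omega> =
                     deconv_kde \<phi>w (char_density k) (h n) (\<sigma> n) n (\<lambda>j. X n j \<omega>) x"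
  shows "weak_conv_m
           (\<lambda>n. distr (M n) borel
              (\<lambda>\<omega>. sqrt (real n * h n * (h n / \<sigma> n) powr (2 * \<beta>))
                    * (est n \<omega> - prob_space.expectation (M n) (est n))))
           (normal_measure 0
              (f x / (2 * pi * C\<^sup>2) * (LBINT t. \<bar>t\<bar> powr (2 * \<beta>) * (cmod (\<phi>w t))\<^sup>2)))"
proof -

  \<comment> \<open>Noise law and real-valuedness of \<open>\<phi>w\<close>\<close>
  define \<kappa> where "\<kappa> = density lborel (\<lambda>y. ennreal (k y))"
  have \<kappa>: "real_distribution \<kappa>"
    unfolding \<kappa>_def by (rule real_distribution_density[OF k_density])
  interpret \<kappa>: real_distribution \<kappa> by fact
  have \<phi>k: "char_density k = char \<kappa>"
    by (simp add: char_density_def \<kappa>_def)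
  have \<phi>w_cont: "continuous_on UNIV \<phi>w"
    by (rule C1_differentiable_imp_continuous_on[OF \<phi>w_C1])
  have \<phi>w_meas [measurable]: "\<phi>w \<in> borel_measurable borel"
    by (rule borel_measurable_continuous_onI[OF \<phi>w_cont])
  have \<phi>w_real: "cnj (\<phi>w t) = \<phi>w t" for t
  proof (rule real_of_real_fourier[OF _ \<phi>w_cont _ \<phi>w_symmetric])
    show "integrable lborel \<phi>w"
      by (rule integrable_bounded_support[OF \<phi>w_meas \<phi>w_support \<phi>w_le_1])
    show "bounded (range \<phi>w)"
      using \<phi>w_le_1 by (auto simp: bounded_iff)
    show "fourier \<phi>w u \<in> \<real>" for u
    proof -
      have "fourier \<phi>w u = of_real (2 * pi * w (- u))"
        using w_fourier[of "- u"] by (simp add: fourier_def)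
      then show ?thesis by simp
    qed
  qed

  \<comment> \<open>Rescaled weights \<open>a n\<close>: uniform bound, integrability and limit
    \<open>A\<close>\<close>
  define \<rho> where "\<rho> n = h n / \<sigma> n" for n
  have \<rho>_pos: "0 < \<rho> n" for n
    using h_pos[of n] \<sigma>_pos[of n] by (simp add: \<rho>_def)
  have \<rho>_lim: "\<rho> \<longlonglongrightarrow> 0"
    using tendsto_inverse_0_at_top[OF \<sigma>_h_tendsto] by (simp add: \<rho>_def[abs_def])
  obtain R where R: "\<rho> n \<le> R" for n
    using Bseq_bdd_above[OF convergent_imp_Bseq[OF convergentI[OF \<rho>_lim]]] by (auto simp: bdd_above_def)
  obtain K where K: "\<And>r t. 0 < r \<Longrightarrow> r \<le> R \<Longrightarrow> \<bar>t\<bar> \<le> 1 \<Longrightarrow> cmod (of_real (r powr \<beta>) / char \<kappa> (t / r)) \<le> K"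
    using powr_over_char_bounded[OF \<kappa> \<phi>k_nonzero[unfolded \<phi>k] \<phi>k_tail[unfolded \<phi>k] C_nonzero \<beta>_nonneg] by blast
  define a where "a n = (\<lambda>t. of_real (\<rho> n powr \<beta>) * \<phi>w t / char_density k (t / \<rho> n))" for n
  define A where "A t = of_real (\<bar>t\<bar> powr \<beta> / C) * \<phi>w t" for t
  have a_meas: "a n \<in> borel_measurable borel" for n
    unfolding a_def \<phi>k by measurable
  have A_meas: "A \<in> borel_measurable borel"
    unfolding A_def[abs_def] by measurable
  have a_supp: "a n t = 0" if "t \<notin> {-1..1}" for n t
    using \<phi>w_support[OF that] by (simp add: a_def)
  have K0: "0 \<le> K"
    by (rule order_trans[OF norm_ge_zero K[OF \<rho>_pos R, of 0 0]]) simp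
  have a_le: "cmod (a n t) \<le> K" for n t
  proof (cases "t \<in> {-1..1}")
    case True
    then have "cmod (of_real (\<rho> n powr \<beta>) / char \<kappa> (t / \<rho> n)) * cmod (\<phi>w t) \<le> K * 1"
      using K[OF \<rho>_pos R, of t n] \<phi>w_le_1[of t] K0 by (intro mult_mono) (auto simp: abs_le_iff)
    then show ?thesis by (simp add: a_def \<phi>k norm_mult norm_divide)
  qed (simp add: a_supp K0)
  have a_int: "integrable lborel (a n)" for n
    by (rule integrable_bounded_support[OF a_meas a_supp a_le])
  have a_lim: "(\<lambda>n. a n (s n)) \<longlonglongrightarrow> A t" if "t \<noteq> 0" "s \<longlonglongrightarrow> t" for t s
  proof -
    have "(\<lambda>n. of_real (\<rho> n powr \<beta>) / char \<kappa> (s n / \<rho> n) * \<phi>w (s n)) \<longlonglongrightarrow> A t"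
      unfolding A_def
    proof (rule tendsto_mult)
      show "(\<lambda>n. of_real (\<rho> n powr \<beta>) / char \<kappa> (s n / \<rho> n)) \<longlonglongrightarrow> of_real (\<bar>t\<bar> powr \<beta> / C)"
        by (rule powr_over_char_tendsto[OF \<phi>k_nonzero[unfolded \<phi>k] \<phi>k_tail[unfolded \<phi>k] C_nonzero
              \<rho>_lim \<rho>_pos that])
      show "(\<lambda>n. \<phi>w (s n)) \<longlonglongrightarrow> \<phi>w t"
        using \<phi>w_cont that(2) by (auto simp: continuous_on_eq_continuous_at intro: isCont_tendsto_compose)
    qed
    then show ?thesis by (simp add: a_def \<phi>k)
  qed
  have a_cnj: "a n (- t) = cnj (a n t)" for n t
    by (simp add: a_def \<phi>k char_minus \<phi>w_symmetric \<phi>w_real)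

  \<comment> \<open>Summands of the estimator and their uniform bound\<close>
  define V where "V n j \<omega> = Re (fourier (a n) ((X n j \<omega> - x) / h n)) / (2 * pi)" for n j \<omega>
  have V_of_real: "complex_of_real (V n j \<omega>) = fourier (a n) ((X n j \<omega> - x) / h n) / (2 * pi)" for n j \<omega>
    unfolding V_def of_real_divide by (subst fourier_real) (simp_all add: a_cnj)
  have V_le: "\<bar>V n j \<omega>\<bar> \<le> K" for n j \<omega>
  proof -
    have "cmod (fourier (a n) ((X n j \<omega> - x) / h n)) \<le> (LBINT t. cmod (a n t))"
      by (rule cmod_fourier_le)
    also have "\<dots> \<le> 2 * K"
      by (rule integral_cmod_bounded_support[OF a_meas a_supp a_le])
    finally have "cmod (fourier (a n) ((X n j \<omega> - x) / h n)) \<le> 2 * K" .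
    moreover have "1 \<le> pi" using pi_gt3 by simp
    then have "2 * K \<le> K * (2 * pi)" using K0 by (simp add: mult_le_cancel_left1)
    ultimately have "\<bar>Re (fourier (a n) ((X n j \<omega> - x) / h n))\<bar> \<le> K * (2 * pi)"
      using abs_Re_le_cmod[of "fourier (a n) ((X n j \<omega> - x) / h n)"] by linarith
    then show ?thesis by (simp add: V_def abs_divide divide_le_eq)
  qed

  \<comment> \<open>Law of the observations and moments of the summands\<close>
  define \<psi> where "\<psi> n r = char_density f r * char \<kappa> (\<sigma> n * r)" for n r
  \<comment> \<open>\<open>P n\<close> and \<open>Q n\<close> carry the first and second moments of
    a summand, up to the factors \<open>h n / (2 * pi)\<close> and \<open>h n / (4 * pi^2)\<close>;
    \<open>\<psi> n\<close> is the characteristic function of one observation.\<close>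
  define P where "P n = (CLBINT r. a n (h n * r) * (iexp (- (r * x)) * \<psi> n r))" for n
  define Q where "Q n = (CLBINT r. conv (a n) (a n) (h n * r) * (iexp (- (r * x)) * \<psi> n r))" for n
  have X_indep: "prob_space.indep_vars (M n) (\<lambda>_. borel) (X n) {1..n}" for n
    using prob_space.indep_vars_add_noise[OF M_prob YZ_indep, of n "\<sigma> n"] by (simp flip: X_def)
  have X_meas: "X n j \<in> borel_measurable (M n)" if "j \<in> {1..n}" for n j
    using that by (rule prob_space.indep_vars_def2[OF M_prob, THEN iffD1, OF X_indep, THEN conjunct1, rule_format])
  have X_char: "char (distr (M n) borel (X n j)) = \<psi> n" if "j \<in> {1..n}" for n j
    using prob_space.char_add_noise[OF M_prob YZ_indep that, of "\<sigma> n"] that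
    by (simp add: char_distributed[OF Y_distr] char_distributed[OF Z_distr] \<phi>k \<psi>_def[abs_def] fun_eq_iff flip: X_def)
  have V_meas [measurable]: "V n j \<in> borel_measurable (M n)" if "j \<in> {1..n}" for n j
    unfolding V_def[abs_def] using X_meas[OF that] fourier_measurable[OF a_meas[of n]] by measurable
  have V_int: "integrable (M n) (V n j)" "integrable (M n) (\<lambda>\<omega>. (V n j \<omega>)\<^sup>2)" if "j \<in> {1..n}" for n j
  proof -
    interpret prob_space "M n" by (rule M_prob)
    show "integrable (M n) (V n j)"
      by (rule integrable_const_bound[where B = K]) (use V_le that in auto)
    show "integrable (M n) (\<lambda>\<omega>. (V n j \<omega>)\<^sup>2)"
      by (rule integrable_const_bound[where B = "K\<^sup>2"]) (use V_le that K0 in \<open>auto simp flip: abs_le_square_iff\<close>)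
  qed
  have EV: "(LINT \<omega>|M n. V n j \<omega>) = h n / (2 * pi) * Re (P n)" if "j \<in> {1..n}" for n j
  proof -
    have "complex_of_real (LINT \<omega>|M n. V n j \<omega>) = (CLINT \<omega>|M n. fourier (a n) ((X n j \<omega> - x) / h n)) / (2 * pi)"
      by (simp add: V_of_real flip: integral_complex_of_real)
    also have "\<dots> = of_real (h n / (2 * pi)) * P n"
      using prob_space.expectation_fourier_affine[OF M_prob X_meas[OF that] a_int[of n] h_pos[of n], of x]
      by (simp add: X_char[OF that] P_def)
    finally have "Re (complex_of_real (LINT \<omega>|M n. V n j \<omega>)) = Re (of_real (h n / (2 * pi)) * P n)"
      by (rule arg_cong)
    then show ?thesis
      by (simp only: times_complex.sel Re_complex_of_real Im_complex_of_real mult_zero_left diff_zero)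
  qed
  have EV2: "(LINT \<omega>|M n. (V n j \<omega>)\<^sup>2) = h n / (4 * pi\<^sup>2) * Re (Q n)" if "j \<in> {1..n}" for n j
  proof -
    \<comment> \<open>Since the transform of \<open>a n\<close> is real, the square of
      \<open>V n j\<close> is its complex square, so the convolution theorem applies without
      conjugates.\<close>
    have "complex_of_real ((V n j \<omega>)\<^sup>2) = fourier (conv (a n) (a n)) ((X n j \<omega> - x) / h n) / (4 * pi\<^sup>2)" for \<omega>
      by (simp add: V_of_real fourier_conv[OF a_int a_int] power2_eq_square)
    then have "complex_of_real (LINT \<omega>|M n. (V n j \<omega>)\<^sup>2)
        = (CLINT \<omega>|M n. fourier (conv (a n) (a n)) ((X n j \<omega> - x) / h n)) / (4 * pi\<^sup>2)"
      by (simp only: integral_complex_of_real[symmetric] integral_divide_zero)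
    also have "\<dots> = of_real (h n / (4 * pi\<^sup>2)) * Q n"
      using prob_space.expectation_fourier_affine[OF M_prob X_meas[OF that] integrable_conv[OF a_int[of n] a_int[of n]] h_pos[of n], of x]
      by (simp add: X_char[OF that] Q_def)
    finally have "Re (complex_of_real (LINT \<omega>|M n. (V n j \<omega>)\<^sup>2)) = Re (of_real (h n / (4 * pi\<^sup>2)) * Q n)"
      by (rule arg_cong)
    then show ?thesis
      by (simp only: times_complex.sel Re_complex_of_real Im_complex_of_real mult_zero_left diff_zero)
  qed

  \<comment> \<open>Limits of the moment integrals and the asymptotic variance\<close>
  have f_inv: "(CLBINT r. iexp (- (r * x)) * char_density f r) = 2 * pi * f x"
  proof -
    have "integrable lborel f"
      using f_density by (intro integrableI_nonneg) (auto simp: prob_density_def)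
    then have 1: "integrable lborel (\<lambda>y. complex_of_real (f y))" by simp
    have 2: "continuous_on UNIV (\<lambda>y. complex_of_real (f y))"
      using f_continuous by (intro continuous_intros)
    have 3: "bounded (range (\<lambda>y. complex_of_real (f y)))"
      using f_bounded by (auto simp: bounded_iff)
    show ?thesis
      using fourier_inversion[OF 1 2 3, of x] \<phi>f_integrable
      by (simp add: char_density_eq_fourier[OF f_density])
  qed
  define v where "v = f x / (2 * pi * C\<^sup>2) * (LBINT t. \<bar>t\<bar> powr (2 * \<beta>) * (cmod (\<phi>w t))\<^sup>2)"
  have AA: "A t * A (- t) = complex_of_real (\<bar>t\<bar> powr (2 * \<beta>) * (cmod (\<phi>w t))\<^sup>2 / C\<^sup>2)" for t
  proof -
    have "\<phi>w t * \<phi>w t = complex_of_real ((cmod (\<phi>w t))\<^sup>2)"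
      using complex_norm_square[of "\<phi>w t"] by (simp add: \<phi>w_real)
    moreover have "\<bar>t\<bar> powr (2 * \<beta>) = \<bar>t\<bar> powr \<beta> * \<bar>t\<bar> powr \<beta>"
      by (simp flip: powr_add)
    moreover have "A t * A (- t) = of_real (\<bar>t\<bar> powr \<beta> * \<bar>t\<bar> powr \<beta> / C\<^sup>2) * (\<phi>w t * \<phi>w t)"
      by (simp add: A_def \<phi>w_symmetric power2_eq_square)
    ultimately show ?thesis by (simp only: of_real_mult[symmetric]) simp
  qed
  have "Q \<longlonglongrightarrow> (CLBINT t. A t * A (- t)) * (CLBINT r. iexp (- (r * x)) * char_density f r)"
    unfolding Q_def[abs_def] \<psi>_def
    by (rule conv_integral_tendsto[where K = K])
       (use a_meas A_meas a_supp a_le a_lim h_tendsto \<sigma>_tendsto \<phi>f_integrable \<kappa> in blast)+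
  \<comment> \<open>The factor \<open>2 * pi * f x / C^2\<close> equals \<open>4 * pi^2\<close>
    times the factor \<open>f x / (2 * pi * C^2)\<close> in \<open>v\<close>.\<close>
  also have "(CLBINT t. A t * A (- t)) * (CLBINT r. iexp (- (r * x)) * char_density f r) = of_real (4 * pi\<^sup>2 * v)"
    unfolding AA f_inv integral_complex_of_real
    by (simp add: v_def power2_eq_square)
  finally have "(\<lambda>n. Re (Q n)) \<longlonglongrightarrow> Re (of_real (4 * pi\<^sup>2 * v))"
    by (rule tendsto_Re)
  then have Q_lim: "(\<lambda>n. Re (Q n) / (4 * pi\<^sup>2)) \<longlonglongrightarrow> v"
    using tendsto_divide[of "\<lambda>n. Re (Q n)" "4 * pi\<^sup>2 * v" sequentially "\<lambda>_. 4 * pi\<^sup>2" "4 * pi\<^sup>2"]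
    unfolding Re_complex_of_real by simp
  \<comment> \<open>From \<open>cmod (a n t) \<le> K\<close> and
    \<open>cmod (\<psi> n r) \<le> cmod (char_density f r)\<close>; the bound is uniform in
    \<open>n\<close>, so the mean of a summand is of order \<open>h n\<close>.\<close>
  define B where "B = K * (LBINT r. cmod (char_density f r))"
  have P_le: "\<bar>Re (P n)\<bar> \<le> B" for n
  proof (rule order_trans[OF abs_Re_le_cmod])
    show "cmod (P n) \<le> B"
      unfolding P_def B_def
    proof (rule cmod_integral_bounded_mult[OF \<phi>f_integrable])
      fix r
      have "cmod (iexp (- (r * x)) * \<psi> n r) \<le> cmod (char_density f r)"
        using \<kappa>.cmod_char_le_1[of "\<sigma> n * r"] by (simp add: \<psi>_def norm_mult mult_left_le)
      then show "cmod (a n (h n * r) * (iexp (- (r * x)) * \<psi> n r)) \<le> K * cmod (char_density f r)"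
        unfolding norm_mult[of "a n _"] using a_le[of n "h n * r"] K0 by (intro mult_mono) auto
    qed
  qed
  have P_lim: "(\<lambda>n. h n * (Re (P n))\<^sup>2 / (4 * pi\<^sup>2)) \<longlonglongrightarrow> 0"
  proof (rule Lim_null_comparison)
    show "(\<lambda>n. h n * B\<^sup>2 / (4 * pi\<^sup>2)) \<longlonglongrightarrow> 0"
      using tendsto_mult_left_zero[OF h_tendsto, of "B\<^sup>2 / (4 * pi\<^sup>2)"] by simp
    have "(Re (P n))\<^sup>2 \<le> B\<^sup>2" for n
      using power_mono[OF P_le[of n] abs_ge_zero, of 2] by simp
    then show "\<forall>\<^sub>F n in sequentially. norm (h n * (Re (P n))\<^sup>2 / (4 * pi\<^sup>2)) \<le> h n * B\<^sup>2 / (4 * pi\<^sup>2)"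
      using h_pos by (auto intro!: always_eventually divide_right_mono mult_left_mono simp: abs_mult less_imp_le)
  qed

  \<comment> \<open>Central limit theorem for the centred, normalised summands\<close>
  define m where "m n j = (LINT \<omega>|M n. V n j \<omega>)" for n j
  define \<xi> where "\<xi> n j \<omega> = (V n j \<omega> - m n j) / sqrt (n * h n)" for n j \<omega>
  have "weak_conv_m (\<lambda>n. distr (M n) borel (\<lambda>\<omega>. \<Sum>j\<in>{1..n}. \<xi> n j \<omega>)) (normal_measure 0 v)"
  proof (rule triangular_array_clt[OF M_prob])
    show "prob_space.indep_vars (M n) (\<lambda>_. borel) (\<xi> n) {1..n}" for n
    proof -
      have "(\<lambda>y. (Re (fourier (a n) ((y - x) / h n)) / (2 * pi) - m n j) / sqrt (n * h n)) \<in> borel_measurable borel" for j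
        using fourier_measurable[OF a_meas[of n]] by measurable
      then have "prob_space.indep_vars (M n) (\<lambda>_. borel)
          (\<lambda>j \<omega>. (Re (fourier (a n) ((X n j \<omega> - x) / h n)) / (2 * pi) - m n j) / sqrt (n * h n)) {1..n}"
        by (intro prob_space.indep_vars_compose2[OF M_prob X_indep])
      then show ?thesis by (simp add: \<xi>_def[abs_def] V_def)
    qed
    \<comment> \<open>A summand and its mean are each at most \<open>K\<close> in modulus;
      \<open>n * h n\<close> tending to infinity makes the terms uniformly small.\<close>
    show "(\<lambda>n. 2 * K / sqrt (n * h n)) \<longlonglongrightarrow> 0"
      by (intro real_tendsto_divide_at_top[OF tendsto_const] filterlim_compose[OF sqrt_at_top nh_tendsto])
    show "\<forall>\<^sub>F n in sequentially. \<forall>j\<in>{1..n}. \<forall>\<omega>\<in>space (M n). \<bar>\<xi> n j \<omega>\<bar> \<le> 2 * K / sqrt (n * h n)"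
    proof (intro always_eventually allI ballI)
      fix n j :: nat and \<omega> assume j: "j \<in> {1..n}"
      interpret prob_space "M n" by (rule M_prob)
      have "\<bar>m n j\<bar> \<le> (LINT \<omega>|M n. K)"
        unfolding m_def using V_int(1)[OF j] V_le
        by (intro order_trans[OF integral_abs_bound] Bochner_Integration.integral_mono) auto
      then have "\<bar>m n j\<bar> \<le> K" by (simp add: prob_space)
      then have "\<bar>V n j \<omega> - m n j\<bar> \<le> 2 * K"
        using V_le[of n j \<omega>] by linarith
      then show "\<bar>\<xi> n j \<omega>\<bar> \<le> 2 * K / sqrt (n * h n)"
        using h_pos[of n] by (simp add: \<xi>_def abs_divide divide_right_mono)
    qed
    fix n j :: nat assume j: "j \<in> {1..n}"
    interpret prob_space "M n" by (rule M_prob)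
    show "expectation (\<xi> n j) = 0"
      unfolding \<xi>_def[abs_def] using V_int(1)[OF j] by (simp add: m_def prob_space)
  next
    have var: "(LINT \<omega>|M n. (\<xi> n j \<omega>)\<^sup>2)
        = (Re (Q n) / (4 * pi\<^sup>2) - h n * (Re (P n))\<^sup>2 / (4 * pi\<^sup>2)) / n" if j: "j \<in> {1..n}" for n j
    proof -
      interpret prob_space "M n" by (rule M_prob)
      have "(\<xi> n j \<omega>)\<^sup>2 = ((V n j \<omega>)\<^sup>2 - 2 * m n j * V n j \<omega> + (m n j)\<^sup>2) / (n * h n)" for \<omega>
        using h_pos[of n] by (simp add: \<xi>_def power_divide power2_diff less_imp_le)
      then have "(LINT \<omega>|M n. (\<xi> n j \<omega>)\<^sup>2) = ((LINT \<omega>|M n. (V n j \<omega>)\<^sup>2) - (m n j)\<^sup>2) / (n * h n)"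
        using V_int[OF j] by (simp add: prob_space m_def[symmetric] power2_eq_square)
      also have "\<dots> = (Re (Q n) / (4 * pi\<^sup>2) - h n * (Re (P n))\<^sup>2 / (4 * pi\<^sup>2)) / n"
        unfolding m_def EV[OF j] EV2[OF j] using h_pos[of n] j
        by (simp add: field_simps power2_eq_square)
      finally show ?thesis .
    qed
    have "(\<lambda>n. Re (Q n) / (4 * pi\<^sup>2) - h n * (Re (P n))\<^sup>2 / (4 * pi\<^sup>2)) \<longlonglongrightarrow> v"
      using tendsto_diff[OF Q_lim P_lim] by simp
    then show "(\<lambda>n. \<Sum>j\<in>{1..n}. LINT \<omega>|M n. (\<xi> n j \<omega>)\<^sup>2) \<longlonglongrightarrow> v"
    proof (rule Lim_transform_eventually)
      show "\<forall>\<^sub>F n in sequentially. Re (Q n) / (4 * pi\<^sup>2) - h n * (Re (P n))\<^sup>2 / (4 * pi\<^sup>2)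
          = (\<Sum>j\<in>{1..n}. LINT \<omega>|M n. (\<xi> n j \<omega>)\<^sup>2)"
        \<comment> \<open>The \<open>n\<close> equal variances cancel the division by
          \<open>n\<close>, except for \<open>n = 0\<close>, where the sum is empty.\<close>
        using eventually_gt_at_top[of 0] by eventually_elim (simp add: var)
    qed
  qed simp

  \<comment> \<open>Identification of the row sum with the normalised estimator\<close>
  moreover have "(\<Sum>j\<in>{1..n}. \<xi> n j \<omega>) = sqrt (real n * h n * (h n / \<sigma> n) powr (2 * \<beta>))
      * (est n \<omega> - prob_space.expectation (M n) (est n))" for n \<omega>
  proof -
    let ?c = "n * h n * \<rho> n powr \<beta>"
    have est: "est n \<omega> = (\<Sum>j=1..n. V n j \<omega>) / ?c" for \<omega>
      unfolding est_def V_def using deconv_kde_eq_sum[OF h_pos \<sigma>_pos, of n n \<beta> \<phi>w "char_density k" n "\<lambda>j. X n j \<omega>" x] a_int[of n]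
      by (simp add: a_def \<rho>_def)
    then have "est n = (\<lambda>\<omega>. (\<Sum>j=1..n. V n j \<omega>) / ?c)" by blast
    then have "(LINT \<omega>|M n. est n \<omega>) = (\<Sum>j=1..n. m n j) / ?c"
      using V_int(1) by (simp add: m_def)
    then have "est n \<omega> - (LINT \<omega>|M n. est n \<omega>) = (\<Sum>j=1..n. V n j \<omega> - m n j) / ?c"
      by (simp add: est sum_subtractf diff_divide_distrib)
    moreover have "sqrt (real n * h n * (h n / \<sigma> n) powr (2 * \<beta>)) = sqrt (n * h n) * \<rho> n powr \<beta>"
    proof -
      have "\<rho> n powr (2 * \<beta>) = (\<rho> n powr \<beta>)\<^sup>2" by (simp add: power2_eq_square flip: powr_add)
      then show ?thesis by (simp add: real_sqrt_mult flip: \<rho>_def)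
    qed
    \<comment> \<open>This covers \<open>n = 0\<close> as well: division by zero makes both sides
      0.\<close>
    moreover have "sqrt (n * h n) * \<rho> n powr \<beta> * (S / ?c) = S / sqrt (n * h n)" for S
    proof -
      have "sqrt (n * h n) * \<rho> n powr \<beta> * (S / ?c) = sqrt (n * h n) / (n * h n) * S"
        using \<rho>_pos[of n] by simp
      also have "sqrt (n * h n) / (n * h n) = inverse (sqrt (n * h n))"
        using h_pos[of n] by (intro sqrt_divide_self_eq) simp
      finally show ?thesis by (simp only: divide_inverse mult.commute)
    qed
    ultimately show ?thesis
      by (simp add: \<xi>_def flip: sum_divide_distrib)
  qed
  ultimately show ?thesis
    by (simp add: v_def)
qed

end
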